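(* Let $k$ be an algebraically closed field and let $\mathcal{N}$ be the nilpotent cone of $\mathfrak{sl}_3$ over $k$. For each $r\ge 1$, the variety $C_r(\mathcal{N})$ is an irreducible variety of dimension $2r+4$.
   Context: $C_r(\mathcal{N})=\{(v_1,\ldots,v_r)\in\mathcal{N}^r\mid [v_i,v_j]=0\text{ for all }i,j\}$, where $\mathcal{N}$ is the variety of nilpotent $3\times3$ matrices. *)

theory Defs
  imports
    "HOL-Analysis.Analysis"
    "HOL-Computational_Algebra.Polynomial"
    "HOL-Library.Extended_Nat"
begin

section \<open>Zariski topology\<close>

text \<open>
  \<^term>\<open>C\<close> is the set of coordinate functions of an affine space whose points are the
  elements of the type \<^typ>\<open>'x\<close>.
\<close>

inductive_set polynomial_functions :: "('x \<Rightarrow> 'k::comm_ring_1) set \<Rightarrow> ('x \<Rightarrow> 'k) set"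
  for C where
  const: "(\<lambda>_. c) \<in> polynomial_functions C"
| coord: "f \<in> C \<Longrightarrow> f \<in> polynomial_functions C"
| add: "f \<in> polynomial_functions C \<Longrightarrow> g \<in> polynomial_functions C \<Longrightarrow>
    (\<lambda>x. f x + g x) \<in> polynomial_functions C"
| mult: "f \<in> polynomial_functions C \<Longrightarrow> g \<in> polynomial_functions C \<Longrightarrow>
    (\<lambda>x. f x * g x) \<in> polynomial_functions C"

definition zero_locus :: "('x \<Rightarrow> 'k::zero) set \<Rightarrow> 'x set" where
  "zero_locus S = {x. \<forall>f\<in>S. f x = 0}"

definition zariski_topology :: "('x \<Rightarrow> 'k::idom) set \<Rightarrow> 'x topology" where
  "zariski_topology C =
     topology (\<lambda>U. \<exists>S\<subseteq>polynomial_functions C. U = - zero_locus S)"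

lemma istopology_zariski:
  fixes C :: "('x \<Rightarrow> 'k::idom) set"
  shows "istopology (\<lambda>U. \<exists>S\<subseteq>polynomial_functions C. U = - zero_locus S)"
  unfolding istopology_def
proof (intro conjI allI impI)
  fix U V
  assume "\<exists>S\<subseteq>polynomial_functions C. U = - zero_locus S"
    and "\<exists>S\<subseteq>polynomial_functions C. V = - zero_locus S"
  then obtain S T where S: "S \<subseteq> polynomial_functions C" "U = - zero_locus S"
    and T: "T \<subseteq> polynomial_functions C" "V = - zero_locus T"
    by blast
  let ?P = "{\<lambda>x. f x * g x |f g. f \<in> S \<and> g \<in> T}"
  have "?P \<subseteq> polynomial_functions C"
    using S(1) T(1) by (auto intro!: polynomial_functions.mult)
  moreover have "U \<inter> V = - zero_locus ?P"
    unfolding S(2) T(2) zero_locus_def by auto (metis mult_eq_0_iff)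
  ultimately show "\<exists>S\<subseteq>polynomial_functions C. U \<inter> V = - zero_locus S"
    by blast
next
  fix \<U>
  assume "\<forall>U\<in>\<U>. \<exists>S\<subseteq>polynomial_functions C. U = - zero_locus S"
  then obtain S where S: "\<And>U. U \<in> \<U> \<Longrightarrow> S U \<subseteq> polynomial_functions C"
      "\<And>U. U \<in> \<U> \<Longrightarrow> U = - zero_locus (S U)"
    by metis
  have "\<Union>\<U> = (\<Union>U\<in>\<U>. - zero_locus (S U))"
    using S(2) by auto
  also have "\<dots> = - zero_locus (\<Union>U\<in>\<U>. S U)"
    by (auto simp: zero_locus_def)
  finally show "\<exists>S\<subseteq>polynomial_functions C. \<Union>\<U> = - zero_locus S"
    using S(1) by (intro exI[of _ "\<Union>U\<in>\<U>. S U"]) blast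
qed

lemma openin_zariski:
  "openin (zariski_topology C) U \<longleftrightarrow>
     (\<exists>S\<subseteq>polynomial_functions C. U = - zero_locus S)"
  unfolding zariski_topology_def by (simp add: topology_inverse'[OF istopology_zariski])

lemma topspace_zariski [simp]: "topspace (zariski_topology C) = UNIV"
proof -
  have "{\<lambda>_. 1} \<subseteq> polynomial_functions C" "UNIV = - zero_locus {\<lambda>_. 1 :: 'b}"
    by (auto simp: zero_locus_def intro: polynomial_functions.const)
  then have "openin (zariski_topology C) UNIV"
    unfolding openin_zariski by blast
  then show ?thesis
    using openin_subset by blast
qed

lemma closedin_zariski:
  "closedin (zariski_topology C) Z \<longleftrightarrow>
     (\<exists>S\<subseteq>polynomial_functions C. Z = zero_locus S)"
  unfolding closedin_def openin_zariski by (auto simp: Compl_eq_Diff_UNIV[symmetric])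

section \<open>Irreducibility and dimension\<close>

definition irreducible_space :: "'x topology \<Rightarrow> bool" where
  "irreducible_space X \<longleftrightarrow>
     topspace X \<noteq> {} \<and>
     (\<forall>A B. closedin X A \<and> closedin X B \<and> topspace X = A \<union> B \<longrightarrow>
        A = topspace X \<or> B = topspace X)"

text \<open>
  Krull dimension: the supremum of the lengths \<open>n\<close> of chains
  \<open>Z 0 \<subset> Z 1 \<subset> \<dots> \<subset> Z n\<close> of irreducible closed subsets.
  For the empty space this definition gives \<open>0\<close>.
\<close>

definition krull_dim :: "'x topology \<Rightarrow> enat" where
  "krull_dim X =
     Sup {enat n |n. \<exists>Z :: nat \<Rightarrow> 'x set.
       (\<forall>i\<le>n. closedin X (Z i) \<and> irreducible_space (subtopology X (Z i))) \<and>
       (\<forall>i<n. Z i \<subset> Z (Suc i))}"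

section \<open>Commuting varieties of matrices\<close>

text \<open>The type-class power of \<^typ>\<open>'k^'n^'n\<close> is entrywise, so powers are iterated \<open>**\<close> here.\<close>

definition nilpotent_matrix :: "'k::semiring_1^'n^'n \<Rightarrow> bool" where
  "nilpotent_matrix A \<longleftrightarrow> (\<exists>m. ((\<lambda>B. A ** B) ^^ m) (mat 1) = 0)"

definition sl :: "('k::comm_ring_1^'n^'n) set" where
  "sl = {A. trace A = 0}"

definition nilpotent_cone :: "('k::comm_ring_1^'n^'n) set" where
  "nilpotent_cone = {A \<in> sl. nilpotent_matrix A}"

definition lie_bracket :: "'k::comm_ring_1^'n^'n \<Rightarrow> 'k^'n^'n \<Rightarrow> 'k^'n^'n" where
  "lie_bracket A B = A ** B - B ** A"

text \<open>The number \<open>r\<close> of entries of the tuples is the cardinality of the index type \<^typ>\<open>'r\<close>.\<close>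

definition commuting_variety :: "('k::comm_ring_1^'n^'n) set \<Rightarrow> (('k^'n^'n)^'r) set" where
  "commuting_variety V =
     {v. (\<forall>i. v $ i \<in> V) \<and> (\<forall>i j. lie_bracket (v $ i) (v $ j) = 0)}"

definition matrix_tuple_coordinates :: "(('k^'n^'n)^'r \<Rightarrow> 'k) set" where
  "matrix_tuple_coordinates = {\<lambda>v. v $ i $ a $ b |i a b. True}"

abbreviation zariski_matrix_tuples :: "(('k::idom^'n^'n)^'r) topology" where
  "zariski_matrix_tuples \<equiv> zariski_topology matrix_tuple_coordinates"

end

theory Submission
  imports Defs "HOL-Library.Function_Algebras"
begin

text \<open>
  Commuting nilpotent matrices stabilize a common flag, so every point of the variety has the form
  \<open>g n g\<^sup>-\<^sup>1\<close> with a tuple \<open>n\<close> of strictly upper triangular matrices; such a tuple commutes iff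
  the superdiagonals \<open>(a\<^sub>i)\<close> and \<open>(c\<^sub>i)\<close> are proportional. Restricting \<open>g\<close> to the lower
  unitriangular matrices (the big cell of the flag variety) and the ratio \<open>c\<^sub>i / a\<^sub>i\<close> to finite
  values gives a polynomial map from affine space of dimension \<open>3 + 1 + 2 r\<close> with dense image.
  Hence the variety is irreducible. A chain of irreducible closed subsets of length \<open>m\<close> yields
  \<open>m\<close> algebraically independent functions, which on affine space \<open>k\<^sup>n\<close> forces \<open>m \<le> n\<close> by counting
  monomials; the closures of the images of the coordinate subspaces form a chain of length
  \<open>n = 2 r + 4\<close>.
\<close>

section \<open>Polynomial functions and irreducible sets\<close>

lemma polynomial_functions_uminus:
  "f \<in> polynomial_functions C \<Longrightarrow> (\<lambda>x. - f x) \<in> polynomial_functions C"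
  using polynomial_functions.mult[OF polynomial_functions.const[of "- 1"]] by fastforce

lemma polynomial_functions_diff:
  assumes "f \<in> polynomial_functions C" "g \<in> polynomial_functions C"
  shows "(\<lambda>x. f x - g x) \<in> polynomial_functions C"
  using polynomial_functions.add[OF assms(1) polynomial_functions_uminus[OF assms(2)]] by simp

lemma polynomial_functions_sum:
  assumes "\<And>i. i \<in> I \<Longrightarrow> f i \<in> polynomial_functions C"
  shows "(\<lambda>x. \<Sum>i\<in>I. f i x) \<in> polynomial_functions C"
proof (cases "finite I")
  case True
  then show ?thesis
    using assms by induction (auto intro: polynomial_functions.const polynomial_functions.add)
qed (simp add: polynomial_functions.const)

lemmas polynomial_functions_intros =
  polynomial_functions.const polynomial_functions.add polynomial_functions.mult
  polynomial_functions_diff polynomial_functions_uminus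

lemma polynomial_functions_power:
  "f \<in> polynomial_functions C \<Longrightarrow> (\<lambda>x. f x ^ n) \<in> polynomial_functions C"
  by (induction n) (auto intro: polynomial_functions_intros)

text \<open>Polynomial maps are encoded by pulling back coordinates to polynomial functions; all
  polynomial functions then follow by induction.\<close>

lemma polynomial_functions_compose:
  assumes "f \<in> polynomial_functions C"
    and "\<And>c. c \<in> C \<Longrightarrow> (\<lambda>y. c (\<phi> y)) \<in> polynomial_functions D"
  shows "(\<lambda>y. f (\<phi> y)) \<in> polynomial_functions D"
  using assms(1) by induction (auto intro: polynomial_functions_intros assms(2))

lemma polynomial_functions_matrix_mult:
  fixes M :: "'x \<Rightarrow> 'k::comm_ring_1^'m^'n" and N :: "'x \<Rightarrow> 'k^'l^'m"
  assumes "\<And>i j. (\<lambda>x. M x $ i $ j) \<in> polynomial_functions C"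
    and "\<And>i j. (\<lambda>x. N x $ i $ j) \<in> polynomial_functions C"
  shows "(\<lambda>x. (M x ** N x) $ i $ j) \<in> polynomial_functions C"
  unfolding matrix_matrix_mult_def vec_lambda_beta
  by (intro polynomial_functions_sum polynomial_functions.mult assms)

section \<open>Polynomial functions on the affine line\<close>

lemma polynomial_functions_line_eq_poly:
  fixes h :: "'k::comm_ring_1 \<Rightarrow> 'k"
  assumes "h \<in> polynomial_functions {\<lambda>\<tau>. \<tau>}"
  shows "\<exists>p. h = poly p"
  using assms
proof induction
  case (const c)
  then show ?case by (intro exI[of _ "[:c:]"]) auto
next
  case (coord f)
  then show ?case by (intro exI[of _ "[:0, 1:]"]) auto
next
  case (add f g)
  then obtain p q where "f = poly p" "g = poly q" by blast
  then show ?case by (intro exI[of _ "p + q"]) auto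
next
  case (mult f g)
  then obtain p q where "f = poly p" "g = poly q" by blast
  then show ?case by (intro exI[of _ "p * q"]) auto
qed

text \<open>The line is irreducible because a nonzero polynomial has finitely many roots.
  Irreducibility of affine space and density of the big cell are both reduced to this case by
  restriction to curves parametrized by the line.\<close>

lemma polynomial_functions_line_mult_zero:
  fixes g h :: "'k::idom \<Rightarrow> 'k"
  assumes inf: "infinite (UNIV :: 'k set)"
    and g: "g \<in> polynomial_functions {\<lambda>\<tau>. \<tau>}" and h: "h \<in> polynomial_functions {\<lambda>\<tau>. \<tau>}"
    and zero: "\<And>\<tau>. g \<tau> * h \<tau> = 0"
  shows "(\<forall>\<tau>. g \<tau> = 0) \<or> (\<forall>\<tau>. h \<tau> = 0)"
proof -
  obtain p q where p: "g = poly p" and q: "h = poly q"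
    using polynomial_functions_line_eq_poly[OF g] polynomial_functions_line_eq_poly[OF h] by auto
  then have "poly (p * q) \<tau> = 0" for \<tau>
    using zero by simp
  then have "p * q = 0"
    using poly_roots_finite[of "p * q"] inf by auto
  then show ?thesis
    by (auto simp: p q)
qed

text \<open>Over a finite field \<open>?p\<close> would have positive degree and take only the value
  1.\<close>

lemma infinite_UNIV_alg_closed_field: "infinite (UNIV :: 'k::alg_closed_field set)"
proof
  assume fin: "finite (UNIV :: 'k set)"
  let ?p = "(\<Prod>a\<in>(UNIV :: 'k set). [:- a, 1:]) + 1"
  have one: "poly ?p x = 1" for x
    using fin by (simp add: poly_prod prod_zero_iff)
  have "degree (\<Prod>a\<in>(UNIV :: 'k set). [:- a, 1:]) = card (UNIV :: 'k set)"
    by (subst degree_prod_eq_sum_degree) auto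
  moreover have "card (UNIV :: 'k set) > 0"
    using fin by (simp add: card_gt_0_iff)
  ultimately have "degree ?p > 0"
    by (subst degree_add_eq_left) auto
  then obtain x where "poly ?p x = 0"
    using alg_closed_imp_poly_has_root by blast
  then show False
    using one by simp
qed

text \<open>An irreducible set is encoded by primality of the ideal of polynomial functions vanishing
  on it.\<close>

definition zariski_prime :: "('x \<Rightarrow> 'k::idom) set \<Rightarrow> 'x set \<Rightarrow> bool" where
  "zariski_prime C Z \<longleftrightarrow> Z \<noteq> {} \<and>
     (\<forall>f\<in>polynomial_functions C. \<forall>g\<in>polynomial_functions C.
        (\<forall>x\<in>Z. f x * g x = 0) \<longrightarrow> (\<forall>x\<in>Z. f x = 0) \<or> (\<forall>x\<in>Z. g x = 0))"

lemma zariski_primeD: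
  assumes "zariski_prime C Z" "f \<in> polynomial_functions C" "g \<in> polynomial_functions C"
    and "\<And>x. x \<in> Z \<Longrightarrow> f x * g x = 0"
  shows "(\<forall>x\<in>Z. f x = 0) \<or> (\<forall>x\<in>Z. g x = 0)"
  using assms unfolding zariski_prime_def by simp

text \<open>Given through the vanishing ideal of \<open>W\<close>, so that comparing polynomial
  functions on \<open>W\<close> and on its closure is a matter of unfolding.\<close>

definition zariski_closure :: "('x \<Rightarrow> 'k::idom) set \<Rightarrow> 'x set \<Rightarrow> 'x set" where
  "zariski_closure C W = zero_locus {f \<in> polynomial_functions C. \<forall>x\<in>W. f x = 0}"

lemma closedin_zariski_closure: "closedin (zariski_topology C) (zariski_closure C W)"
  unfolding zariski_closure_def closedin_zariski
  by (rule exI[of _ "{f \<in> polynomial_functions C. \<forall>x\<in>W. f x = 0}"]) auto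

lemma zariski_closure_superset: "W \<subseteq> zariski_closure C W"
  unfolding zariski_closure_def zero_locus_def by blast

lemma zariski_closure_mono: "V \<subseteq> W \<Longrightarrow> zariski_closure C V \<subseteq> zariski_closure C W"
  unfolding zariski_closure_def zero_locus_def by blast

lemma zariski_closure_minimal:
  assumes "closedin (zariski_topology C) Z" "W \<subseteq> Z"
  shows "zariski_closure C W \<subseteq> Z"
proof -
  obtain S where S: "S \<subseteq> polynomial_functions C" "Z = zero_locus S"
    using assms(1) unfolding closedin_zariski by blast
  then have "S \<subseteq> {f \<in> polynomial_functions C. \<forall>x\<in>W. f x = 0}"
    using assms(2) by (auto simp: zero_locus_def)
  then show ?thesis
    unfolding S(2) zariski_closure_def zero_locus_def by blast
qed

lemma zero_on_zariski_closure_iff: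
  assumes "f \<in> polynomial_functions C"
  shows "(\<forall>x\<in>zariski_closure C W. f x = 0) \<longleftrightarrow> (\<forall>x\<in>W. f x = 0)"
  using assms unfolding zariski_closure_def zero_locus_def by blast

text \<open>Apart from nonemptiness, primality depends only on the vanishing ideal, which
  \<open>W\<close> shares with its closure.\<close>

lemma zariski_prime_closure:
  assumes "zariski_prime C W"
  shows "zariski_prime C (zariski_closure C W)"
proof -
  have "(\<forall>x\<in>zariski_closure C W. f x * g x = 0) \<longleftrightarrow> (\<forall>x\<in>W. f x * g x = 0)"
    if "f \<in> polynomial_functions C" "g \<in> polynomial_functions C" for f g
    using zero_on_zariski_closure_iff[OF polynomial_functions.mult[OF that]] .
  then show ?thesis
    using assms zariski_closure_superset[of W C] unfolding zariski_prime_def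
    by (simp add: zero_on_zariski_closure_iff) auto
qed

lemma zariski_prime_image:
  assumes "zariski_prime D W"
    and "\<And>c. c \<in> C \<Longrightarrow> (\<lambda>y. c (\<phi> y)) \<in> polynomial_functions D"
  shows "zariski_prime C (\<phi> ` W)"
  using assms(1) polynomial_functions_compose[of _ C \<phi> D] assms(2)
  unfolding zariski_prime_def by simp

text \<open>Functions with product zero on \<open>Z\<close> cut out a closed cover of
  \<open>Z\<close>. Conversely, a cover by two proper closed subsets yields an equation of each,
  nonzero somewhere on \<open>Z\<close>, with product zero on \<open>Z\<close>.\<close>

lemma irreducible_space_zariski_iff:
  "irreducible_space (subtopology (zariski_topology C) Z) \<longleftrightarrow> zariski_prime C Z"
proof
  assume irr: "irreducible_space (subtopology (zariski_topology C) Z)"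
  show "zariski_prime C Z"
    unfolding zariski_prime_def
  proof (intro conjI ballI impI)
    show "Z \<noteq> {}"
      using irr by (simp add: irreducible_space_def)
  next
    fix f g
    assume f: "f \<in> polynomial_functions C" and g: "g \<in> polynomial_functions C"
      and zero: "\<forall>x\<in>Z. f x * g x = 0"
    have cl: "closedin (subtopology (zariski_topology C) Z) (Z \<inter> zero_locus {h})"
      if "h \<in> polynomial_functions C" for h
      using that by (intro closedin_subtopology_Int_closed) (auto simp: closedin_zariski)
    have "Z = (Z \<inter> zero_locus {f}) \<union> (Z \<inter> zero_locus {g})"
      using zero by (auto simp: zero_locus_def)
    then have "Z \<inter> zero_locus {f} = Z \<or> Z \<inter> zero_locus {g} = Z"
      using irr cl[OF f] cl[OF g] unfolding irreducible_space_def
      by (metis topspace_subtopology topspace_zariski Int_UNIV_left)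
    then show "(\<forall>x\<in>Z. f x = 0) \<or> (\<forall>x\<in>Z. g x = 0)"
      by (auto simp: zero_locus_def)
  qed
next
  assume prime: "zariski_prime C Z"
  show "irreducible_space (subtopology (zariski_topology C) Z)"
    unfolding irreducible_space_def
  proof (intro conjI allI impI)
    show "topspace (subtopology (zariski_topology C) Z) \<noteq> {}"
      using prime by (simp add: zariski_prime_def)
  next
    fix A B
    assume AB: "closedin (subtopology (zariski_topology C) Z) A \<and>
      closedin (subtopology (zariski_topology C) Z) B \<and>
      topspace (subtopology (zariski_topology C) Z) = A \<union> B"
    then obtain S T where S: "S \<subseteq> polynomial_functions C" "A = Z \<inter> zero_locus S"
      and T: "T \<subseteq> polynomial_functions C" "B = Z \<inter> zero_locus T"
      unfolding closedin_subtopology closedin_zariski by blast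
    have Z: "Z = A \<union> B"
      using AB by simp
    show "A = topspace (subtopology (zariski_topology C) Z) \<or>
      B = topspace (subtopology (zariski_topology C) Z)"
    proof (rule ccontr)
      assume "\<not> ?thesis"
      then obtain x y where "x \<in> Z" "x \<notin> A" "y \<in> Z" "y \<notin> B"
        using Z by auto
      then obtain f g where fg: "f \<in> S" "f x \<noteq> 0" "g \<in> T" "g y \<noteq> 0"
        using S(2) T(2) by (auto simp: zero_locus_def)
      have "\<forall>z\<in>Z. f z * g z = 0"
        using Z S(2) T(2) fg by (auto simp: zero_locus_def)
      then show False
        using prime fg S(1) T(1) \<open>x \<in> Z\<close> \<open>y \<in> Z\<close> unfolding zariski_prime_def by blast
    qed
  qed
qed

text \<open>Affine \<open>n\<close>-space is modelled by sequences of which only the first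
  \<open>n\<close> entries count as coordinates; so \<open>n\<close> can be any number, and the
  coordinate subspaces are given by vanishing tails.\<close>

abbreviation sequence_coordinates :: "nat \<Rightarrow> ((nat \<Rightarrow> 'k) \<Rightarrow> 'k) set" where
  "sequence_coordinates n \<equiv> (\<lambda>j y. y j) ` {..<n}"

text \<open>A point where \<open>f\<close> is nonzero and one where \<open>g\<close> is nonzero are
  joined by a line inside the subspace, and the line is irreducible.\<close>

lemma zariski_prime_initial_sequences:
  fixes j n :: nat
  assumes inf: "infinite (UNIV :: 'k::idom set)"
  shows "zariski_prime (sequence_coordinates n) {y :: nat \<Rightarrow> 'k. \<forall>i\<ge>j. y i = 0}"
    (is "zariski_prime ?C ?W")
  unfolding zariski_prime_def
proof (intro conjI ballI impI)
  show "?W \<noteq> {}"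
    by (auto intro: exI[of _ "\<lambda>_. 0"])
next
  fix f g
  assume f: "f \<in> polynomial_functions ?C" and g: "g \<in> polynomial_functions ?C"
    and zero: "\<forall>y\<in>?W. f y * g y = 0"
  show "(\<forall>y\<in>?W. f y = 0) \<or> (\<forall>y\<in>?W. g y = 0)"
  proof (rule ccontr)
    assume "\<not> ?thesis"
    then obtain y z where y: "y \<in> ?W" "f y \<noteq> 0" and z: "z \<in> ?W" "g z \<noteq> 0"
      by blast
    define l where "l = (\<lambda>\<tau> i. y i + \<tau> * (z i - y i))"
    have l: "(\<lambda>\<tau>. h (l \<tau>)) \<in> polynomial_functions {\<lambda>\<tau>. \<tau>}"
      if "h \<in> polynomial_functions ?C" for h
      using that
      by (rule polynomial_functions_compose)
         (auto simp: l_def intro!: polynomial_functions_intros intro: polynomial_functions.coord)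
    have "f (l \<tau>) * g (l \<tau>) = 0" for \<tau>
      using zero y(1) z(1) by (simp add: l_def)
    then have "(\<forall>\<tau>. f (l \<tau>) = 0) \<or> (\<forall>\<tau>. g (l \<tau>) = 0)"
      by (rule polynomial_functions_line_mult_zero[OF inf l[OF f] l[OF g]])
    moreover have "l 0 = y" "l 1 = z"
      by (auto simp: l_def)
    ultimately show False
      using y(2) z(2) by metis
  qed
qed

section \<open>Dimension of a parametrized set\<close>

text \<open>The exponents are the \<open>m\<close> lowest base-\<open>D\<close> digits of \<open>e\<close>.\<close>

fun digit_monomial :: "(nat \<Rightarrow> 'x \<Rightarrow> 'k::comm_ring_1) \<Rightarrow> nat \<Rightarrow> nat \<Rightarrow> nat \<Rightarrow> 'x \<Rightarrow> 'k" where
  "digit_monomial f D 0 e x = 1"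
| "digit_monomial f D (Suc m) e x = f m x ^ (e div D ^ m) * digit_monomial f D m (e mod D ^ m) x"

lemma polynomial_functions_digit_monomial:
  assumes "\<And>i. i < m \<Longrightarrow> f i \<in> polynomial_functions C"
  shows "digit_monomial f D m e \<in> polynomial_functions C"
  using assms
proof (induction m arbitrary: e)
  case 0
  then show ?case
    using polynomial_functions.const[of 1 C] by (simp add: fun_eq_iff[symmetric])
next
  case (Suc m)
  have "digit_monomial f D (Suc m) e =
      (\<lambda>x. f m x ^ (e div D ^ m) * digit_monomial f D m (e mod D ^ m) x)"
    by auto
  then show ?case
    using Suc by (auto intro!: polynomial_functions.mult polynomial_functions_power)
qed

text \<open>Sorts the exponent codes by their leading digit \<open>a\<close>; for
  \<open>N = D ^ m\<close> this separates the power of the last function from the other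
  ones.\<close>

lemma sum_digits:
  fixes g :: "nat \<Rightarrow> 'k::comm_monoid_add"
  shows "(\<Sum>e<D * N. g e) = (\<Sum>a<D. \<Sum>e<N. g (a * N + e))"
proof -
  have "(\<Sum>e<D * N. g e) = (\<Sum>a<D. sum g {a * N..<a * N + N})"
    by (simp add: sum.nat_group)
  also have "\<dots> = (\<Sum>a<D. \<Sum>e<N. g (a * N + e))"
  proof (rule sum.cong[OF refl])
    fix a
    show "sum g {a * N..<a * N + N} = (\<Sum>e<N. g (a * N + e))"
      by (rule sum.reindex_bij_witness[of _ "\<lambda>e. a * N + e" "\<lambda>e. e - a * N"]) auto
  qed
  finally show ?thesis .
qed

text \<open>A strict chain of irreducible sets yields algebraically independent functions: a relation on
  the larger set can be divided by a power of the last function until it restricts to a nontrivial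
  relation on the smaller set.\<close>

lemma digit_monomials_independent:
  fixes f :: "nat \<Rightarrow> 'x \<Rightarrow> 'k::idom"
  assumes prime: "\<And>i. i \<le> m \<Longrightarrow> zariski_prime C (Z i)"
    and sub: "\<And>i. i < m \<Longrightarrow> Z i \<subseteq> Z (Suc i)"
    and poly: "\<And>i. i < m \<Longrightarrow> f i \<in> polynomial_functions C"
    and vanish: "\<And>i x. i < m \<Longrightarrow> x \<in> Z i \<Longrightarrow> f i x = 0"
    and nonzero: "\<And>i. i < m \<Longrightarrow> \<exists>x\<in>Z (Suc i). f i x \<noteq> 0"
    and relation: "\<And>x. x \<in> Z m \<Longrightarrow> (\<Sum>e<D ^ m. c e * digit_monomial f D m e x) = 0"
    and e: "e < D ^ m"
  shows "c e = 0"
  using assms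
proof (induction m arbitrary: c e)
  case 0
  have "Z 0 \<noteq> {}"
    using 0(1)[of 0] by (simp add: zariski_prime_def)
  then obtain x where "x \<in> Z 0" by auto
  with 0(6)[of x] 0(7) show ?case by simp
next
  case (Suc m)
  define N where "N = D ^ m"
  \<comment> \<open>The relation becomes a polynomial in \<open>f m\<close> with coefficient
    functions \<open>g a\<close>, which are combinations of digit monomials in the first
    \<open>m\<close> functions.\<close>
  define g where "g a x = (\<Sum>e<N. c (a * N + e) * digit_monomial f D m e x)" for a x
  have g_poly: "g a \<in> polynomial_functions C" for a
    unfolding g_def using Suc.prems(3)
    by (intro polynomial_functions_sum polynomial_functions.mult polynomial_functions.const
        polynomial_functions_digit_monomial) auto
  have f_poly: "f m \<in> polynomial_functions C"
    using Suc.prems(3) by simp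
  have rel: "(\<Sum>a<D. f m x ^ a * g a x) = 0" if "x \<in> Z (Suc m)" for x
  proof -
    have "0 = (\<Sum>e<D * N. c e * digit_monomial f D (Suc m) e x)"
      using Suc.prems(6)[OF that] by (simp add: N_def)
    also have "\<dots> = (\<Sum>a<D. \<Sum>e<N. c (a * N + e) * (f m x ^ a * digit_monomial f D m e x))"
      unfolding sum_digits by (intro sum.cong refl) (auto simp flip: N_def)
    also have "\<dots> = (\<Sum>a<D. f m x ^ a * g a x)"
      unfolding g_def sum_distrib_left by (simp add: mult_ac)
    finally show ?thesis by simp
  qed
  have coeff: "\<forall>e<N. c (a * N + e) = 0" if "a < D" for a
    using that
  proof (induction a rule: less_induct)
    case (less a)
    \<comment> \<open>The coefficients below \<open>a\<close> vanish by induction, so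
      \<open>f m ^ a\<close> can be factored out; \<open>h\<close> is the quotient.\<close>
    define h where "h x = (\<Sum>b<D - a. f m x ^ b * g (a + b) x)" for x
    have h_poly: "h \<in> polynomial_functions C"
      unfolding h_def
      by (intro polynomial_functions_sum polynomial_functions.mult polynomial_functions_power
          f_poly g_poly)
    have "f m x ^ a * h x = 0" if x: "x \<in> Z (Suc m)" for x
    proof -
      have "g b x = 0" if "b < a" for b
        using less.IH[OF that] less.prems that by (simp add: g_def)
      then have "(\<Sum>b<a. f m x ^ b * g b x) = 0"
        by simp
      then have "0 = (\<Sum>b=a..<D. f m x ^ b * g b x)"
        using rel[OF x] less.prems
        by (simp add: lessThan_atLeast0 sum.atLeastLessThan_concat[of 0 a D, symmetric])
      also have "\<dots> = (\<Sum>b<D - a. f m x ^ (a + b) * g (a + b) x)"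
        by (intro sum.reindex_bij_witness[of _ "\<lambda>b. a + b" "\<lambda>b. b - a"]) auto
      finally show ?thesis
        by (simp add: h_def sum_distrib_left power_add mult_ac)
    qed
    \<comment> \<open>Primality of \<open>Z (Suc m)\<close> cancels the power of \<open>f m\<close>,
      which is nonzero somewhere on that set.\<close>
    then have "(\<forall>x\<in>Z (Suc m). f m x ^ a = 0) \<or> (\<forall>x\<in>Z (Suc m). h x = 0)"
      by (intro zariski_primeD[OF Suc.prems(1)[of "Suc m"]] h_poly
          polynomial_functions_power f_poly) simp_all
    moreover have "\<exists>x\<in>Z (Suc m). f m x ^ a \<noteq> 0"
      using Suc.prems(5)[of m] by auto
    ultimately have h0: "\<forall>x\<in>Z (Suc m). h x = 0"
      by blast
    \<comment> \<open>On \<open>Z m\<close> only the constant term of \<open>h\<close> in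
      \<open>f m\<close> survives. This gives a relation of length \<open>m\<close> for the outer
      induction hypothesis.\<close>
    have "g a x = 0" if x: "x \<in> Z m" for x
    proof -
      have "h x = (\<Sum>b<D - a. if b = 0 then g a x else 0)"
        unfolding h_def using Suc.prems(4)[of m x] x by (intro sum.cong) auto
      also have "\<dots> = g a x"
        using less.prems by simp
      finally show ?thesis
        using h0 Suc.prems(2)[of m] x by auto
    qed
    then show ?case
      using Suc.IH[of "\<lambda>e. c (a * N + e)"] Suc.prems(1-5) unfolding g_def N_def by auto
  qed
  have "e div N < D"
    using Suc.prems(7) by (simp add: N_def less_mult_imp_div_less)
  moreover have "e mod N < N"
    using Suc.prems(7) by (cases "N = 0") (auto simp: N_def)
  ultimately show ?case
    using coeff[of "e div N"] by (metis div_mult_mod_eq)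
qed

text \<open>The bound on independent sets, stated for indexed families: uniqueness of coefficients
  also forces the indexing to be injective.\<close>

lemma (in vector_space) card_le_if_coefficients_unique:
  assumes "finite T" "finite E" "F ` E \<subseteq> span T"
    and unique: "\<And>c e. (\<Sum>e\<in>E. scale (c e) (F e)) = 0 \<Longrightarrow> e \<in> E \<Longrightarrow> c e = 0"
  shows "card E \<le> card T"
proof -
  have inj: "inj_on F E"
  proof (rule inj_onI, rule ccontr)
    fix d e assume de: "d \<in> E" "e \<in> E" "F d = F e" "d \<noteq> e"
    \<comment> \<open>A repeated value would give the relation with coefficients 1 and -1.\<close>
    define c :: "_ \<Rightarrow> 'a" where "c = (\<lambda>i. (if i = d then 1 else 0) - (if i = e then 1 else 0))"
    have "(\<Sum>i\<in>E. scale (c i) (F i)) =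
        (\<Sum>i\<in>E. if i = d then F i else 0) - (\<Sum>i\<in>E. if i = e then F i else 0)"
      unfolding sum_subtractf[symmetric] c_def by (intro sum.cong) (auto simp: scale_left_diff_distrib)
    also have "\<dots> = 0"
      using de assms(2) by simp
    finally show False
      using unique[of c d] de by (simp add: c_def)
  qed
  have "independent (F ` E)"
  proof (rule independent_if_scalars_zero)
    fix u x assume "(\<Sum>x\<in>F ` E. scale (u x) x) = 0" "x \<in> F ` E"
    then show "u x = 0"
      using unique[of "\<lambda>e. u (F e)"] by (auto simp: sum.reindex[OF inj])
  qed (use assms in auto)
  then have "card (F ` E) \<le> card T"
    using independent_span_bound assms by blast
  then show ?thesis
    by (simp add: card_image[OF inj])
qed

section \<open>Spans of monomials with bounded exponents\<close>

interpretation function_space: vector_space "\<lambda>(c :: 'k::field) (f :: 'y \<Rightarrow> 'k) y. c * f y"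
  by unfold_locales (auto simp: fun_eq_iff algebra_simps)

text \<open>Each exponent is bounded separately, not the total degree, which makes the count a plain
  power.\<close>

definition sequence_monomials :: "nat \<Rightarrow> nat \<Rightarrow> ((nat \<Rightarrow> 'k::comm_ring_1) \<Rightarrow> 'k) set" where
  "sequence_monomials n d = (\<lambda>e y. \<Prod>j<n. y j ^ e j) ` {e. \<forall>j<n. e j \<le> d}"

text \<open>Extensional exponent functions form a finite index set, whereas those in the definition
  are arbitrary beyond \<open>n\<close>.\<close>

lemma sequence_monomials_eq:
  "sequence_monomials n d = (\<lambda>e y. \<Prod>j<n. y j ^ e j) ` (PiE {..<n} (\<lambda>_. {..d}))"
proof
  show "sequence_monomials n d \<subseteq> (\<lambda>e y. \<Prod>j<n. y j ^ e j) ` (PiE {..<n} (\<lambda>_. {..d}))"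
  proof
    fix p assume "p \<in> sequence_monomials n d"
    then obtain e where "p = (\<lambda>y. \<Prod>j<n. y j ^ e j)" "\<forall>j<n. e j \<le> d"
      unfolding sequence_monomials_def by auto
    then show "p \<in> (\<lambda>e y. \<Prod>j<n. y j ^ e j) ` (PiE {..<n} (\<lambda>_. {..d}))"
      by (intro image_eqI[of _ _ "restrict e {..<n}"]) auto
  qed
qed (auto simp: sequence_monomials_def PiE_iff)

lemma finite_sequence_monomials: "finite (sequence_monomials n d)"
  and card_sequence_monomials: "card (sequence_monomials n d) \<le> Suc d ^ n"
proof -
  have fin: "finite (PiE {..<n} (\<lambda>_. {..d}))"
    by (intro finite_PiE) auto
  show "finite (sequence_monomials n d)"
    unfolding sequence_monomials_eq using fin by blast
  show "card (sequence_monomials n d) \<le> Suc d ^ n"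
    unfolding sequence_monomials_eq using card_image_le[OF fin] by (fastforce simp: card_PiE)
qed

lemma span_sequence_monomials_mono:
  "d \<le> d' \<Longrightarrow> function_space.span (sequence_monomials n d) \<subseteq> function_space.span (sequence_monomials n d')"
  by (intro function_space.span_mono) (force simp: sequence_monomials_def)

text \<open>Exponents of monomials add; linearity extends this first to the right factor and then to
  the left one.\<close>

lemma span_sequence_monomials_mult:
  fixes f g :: "(nat \<Rightarrow> 'k::field) \<Rightarrow> 'k"
  assumes "f \<in> function_space.span (sequence_monomials n d)"
    and "g \<in> function_space.span (sequence_monomials n d')"
  shows "(\<lambda>y. f y * g y) \<in> function_space.span (sequence_monomials n (d + d'))"
    (is "_ \<in> ?S")
proof -
  have monomials: "(\<lambda>y. p y * q y) \<in> ?S"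
    if "p \<in> sequence_monomials n d" "q \<in> sequence_monomials n d'" for p q
  proof -
    obtain e e' where p: "p = (\<lambda>y. \<Prod>j<n. y j ^ e j)" "\<forall>j<n. e j \<le> d"
      and q: "q = (\<lambda>y. \<Prod>j<n. y j ^ e' j)" "\<forall>j<n. e' j \<le> d'"
      using \<open>p \<in> _\<close> \<open>q \<in> _\<close> unfolding sequence_monomials_def by auto
    have "(\<lambda>y. p y * q y) = (\<lambda>y. \<Prod>j<n. y j ^ (e j + e' j))"
      by (simp add: p(1) q(1) power_add prod.distrib)
    moreover have "\<forall>j<n. e j + e' j \<le> d + d'"
      using p(2) q(2) by (simp add: add_mono)
    ultimately show ?thesis
      by (intro function_space.span_base) (auto simp: sequence_monomials_def)
  qed
  have zero: "(\<lambda>y. 0) \<in> ?S"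
    using function_space.span_zero by (simp add: zero_fun_def)
  have add: "(\<lambda>y. u y + v y) \<in> ?S" if "u \<in> ?S" "v \<in> ?S" for u v
    using function_space.span_add[OF that] by (simp add: plus_fun_def)
  have left: "(\<lambda>y. p y * q y) \<in> ?S" if "p \<in> sequence_monomials n d"
    "q \<in> function_space.span (sequence_monomials n d')" for p q
    using that(2)
  proof (induction rule: function_space.span_induct_alt)
    case (step c u v)
    have "(\<lambda>y. c * (p y * u y) + p y * v y) \<in> ?S"
      by (intro add function_space.span_scale monomials that(1) step)
    then show ?case
      by (simp add: algebra_simps)
  qed (simp add: zero)
  show ?thesis
    using assms(1)
  proof (induction rule: function_space.span_induct_alt)
    case (step c u v)
    have "(\<lambda>y. c * (u y * g y) + v y * g y) \<in> ?S"
      by (intro add function_space.span_scale left assms(2) step)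
    then show ?case
      by (simp add: algebra_simps)
  qed (simp add: zero)
qed

lemma one_in_span_sequence_monomials: "(\<lambda>y. 1) \<in> function_space.span (sequence_monomials n 0)"
  by (intro function_space.span_base) (force simp: sequence_monomials_def)

lemma span_sequence_monomials_power:
  assumes "f \<in> function_space.span (sequence_monomials n d)"
  shows "(\<lambda>y. f y ^ a) \<in> function_space.span (sequence_monomials n (a * d))"
proof (induction a)
  case (Suc a)
  then show ?case
    using span_sequence_monomials_mult[OF assms Suc] by simp
qed (simp add: one_in_span_sequence_monomials)

lemma polynomial_functions_in_span_monomials:
  fixes f :: "(nat \<Rightarrow> 'k::field) \<Rightarrow> 'k"
  assumes "f \<in> polynomial_functions (sequence_coordinates n)"
  shows "\<exists>d. f \<in> function_space.span (sequence_monomials n d)"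
  using assms
proof induction
  case (const c)
  have "(\<lambda>y :: nat \<Rightarrow> 'k. c * 1) \<in> function_space.span (sequence_monomials n 0)"
    by (intro function_space.span_scale one_in_span_sequence_monomials)
  then show ?case by auto
next
  case (coord f)
  then obtain j where j: "j < n" "f = (\<lambda>y. y j)" by auto
  have "(\<lambda>y :: nat \<Rightarrow> 'k. \<Prod>i<n. y i ^ (if i = j then 1 else 0)) \<in> sequence_monomials n 1"
    unfolding sequence_monomials_def by (rule image_eqI[OF refl]) auto
  then have "(\<lambda>y :: nat \<Rightarrow> 'k. \<Prod>i<n. y i ^ (if i = j then 1 else 0)) \<in>
      function_space.span (sequence_monomials n 1)"
    by (rule function_space.span_base)
  moreover have "(\<lambda>y. \<Prod>i<n. y i ^ (if i = j then 1 else 0)) = f"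
  proof
    fix y :: "nat \<Rightarrow> 'k"
    have "(\<Prod>i<n. y i ^ (if i = j then 1 else 0)) = (\<Prod>i<n. if i = j then y i else 1)"
      by (intro prod.cong) auto
    then show "(\<Prod>i<n. y i ^ (if i = j then 1 else 0)) = f y"
      using j by simp
  qed
  ultimately show ?case
    by (intro exI[of _ 1]) (simp only:)
next
  case (add f g)
  then obtain d d' where "f \<in> function_space.span (sequence_monomials n d)"
      "g \<in> function_space.span (sequence_monomials n d')" by blast
  then have "f \<in> function_space.span (sequence_monomials n (max d d'))"
      "g \<in> function_space.span (sequence_monomials n (max d d'))"
    using span_sequence_monomials_mono[of d "max d d'" n] span_sequence_monomials_mono[of d' "max d d'" n]
    by auto
  from function_space.span_add[OF this] show ?case
    by (auto simp: plus_fun_def)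
next
  case (mult f g)
  then show ?case
    using span_sequence_monomials_mult by blast
qed

text \<open>Every digit is below \<open>D\<close>, so each of the \<open>m\<close> powers raises the
  exponent bound by at most \<open>D * d\<close>.\<close>

lemma digit_monomial_in_span:
  fixes f :: "nat \<Rightarrow> 'x \<Rightarrow> 'k::field"
  assumes "\<And>i. i < m \<Longrightarrow> (\<lambda>y. f i (\<psi> y)) \<in> function_space.span (sequence_monomials n d)"
    and "e < D ^ m"
  shows "(\<lambda>y. digit_monomial f D m e (\<psi> y)) \<in> function_space.span (sequence_monomials n (m * (D * d)))"
  using assms
proof (induction m arbitrary: e)
  case 0
  then show ?case
    by (simp add: one_in_span_sequence_monomials)
next
  case (Suc m)
  define N where "N = D ^ m"
  have "e div N < D"
    using Suc.prems(2) by (simp add: N_def less_mult_imp_div_less)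
  then have "(\<lambda>y. f m (\<psi> y) ^ (e div N)) \<in> function_space.span (sequence_monomials n (D * d))"
    using span_sequence_monomials_power[OF Suc.prems(1)[of m], of "e div N"]
      span_sequence_monomials_mono[of "e div N * d" "D * d" n] by auto
  moreover have "e mod N < D ^ m"
    using Suc.prems(2) by (cases "N = 0") (auto simp: N_def)
  then have "(\<lambda>y. digit_monomial f D m (e mod N) (\<psi> y)) \<in>
      function_space.span (sequence_monomials n (m * (D * d)))"
    using Suc by simp
  ultimately show ?case
    using span_sequence_monomials_mult by (fastforce simp: N_def)
qed

text \<open>The \<open>D ^ m\<close> digit monomials stay independent after pullback along the dense
  map \<open>\<psi>\<close>, but lie in a span whose dimension grows at most like a constant times
  \<open>D ^ n\<close>. For large \<open>D\<close> this excludes \<open>m > n\<close>.\<close>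

lemma chain_length_le:
  fixes f :: "nat \<Rightarrow> 'x \<Rightarrow> 'k::field" and \<psi> :: "(nat \<Rightarrow> 'k) \<Rightarrow> 'x"
  assumes coords: "\<And>c. c \<in> C \<Longrightarrow> (\<lambda>y. c (\<psi> y)) \<in> polynomial_functions (sequence_coordinates n)"
    and dense: "Z m \<subseteq> zariski_closure C (range \<psi>)"
    and prime: "\<And>i. i \<le> m \<Longrightarrow> zariski_prime C (Z i)"
    and sub: "\<And>i. i < m \<Longrightarrow> Z i \<subseteq> Z (Suc i)"
    and poly: "\<And>i. i < m \<Longrightarrow> f i \<in> polynomial_functions C"
    and vanish: "\<And>i x. i < m \<Longrightarrow> x \<in> Z i \<Longrightarrow> f i x = 0"
    and nonzero: "\<And>i. i < m \<Longrightarrow> \<exists>x\<in>Z (Suc i). f i x \<noteq> 0"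
  shows "m \<le> n"
proof (rule ccontr)
  assume "\<not> m \<le> n"
  have "\<exists>d. (\<lambda>y. f i (\<psi> y)) \<in> function_space.span (sequence_monomials n d)" if "i < m" for i
    by (intro polynomial_functions_in_span_monomials polynomial_functions_compose[OF poly[OF that]] coords)
  then obtain d where d: "\<And>i. i < m \<Longrightarrow> (\<lambda>y. f i (\<psi> y)) \<in> function_space.span (sequence_monomials n (d i))"
    by metis
  define d' where "d' = (\<Sum>i<m. d i)"
  have d': "(\<lambda>y. f i (\<psi> y)) \<in> function_space.span (sequence_monomials n d')" if "i < m" for i
    using d[OF that] span_sequence_monomials_mono[of "d i" d' n] member_le_sum[of i "{..<m}" d] that
    by (auto simp: d'_def)
  define K where "K = m * d'"
  have bound: "D ^ m \<le> Suc (D * K) ^ n" for D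
  proof -
    define F where "F e = (\<lambda>y. digit_monomial f D m e (\<psi> y))" for e
    have "card {..<D ^ m} \<le> card (sequence_monomials n (m * (D * d')) :: ((nat \<Rightarrow> 'k) \<Rightarrow> 'k) set)"
    proof (rule function_space.card_le_if_coefficients_unique)
      show "F ` {..<D ^ m} \<subseteq> function_space.span (sequence_monomials n (m * (D * d')))"
        unfolding F_def using d' by (auto intro!: digit_monomial_in_span)
    next
      fix c e assume c: "(\<Sum>e<D ^ m. (\<lambda>y. c e * F e y)) = 0" and e: "e \<in> {..<D ^ m}"
      let ?h = "\<lambda>x. \<Sum>e<D ^ m. c e * digit_monomial f D m e x"
      have sum_fun: "sum g A y = (\<Sum>a\<in>A. g a y)"
        for g :: "nat \<Rightarrow> (nat \<Rightarrow> 'k) \<Rightarrow> 'k" and A y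
        by (induction A rule: infinite_finite_induct) auto
      have "?h \<in> polynomial_functions C"
        by (intro polynomial_functions_sum polynomial_functions.mult polynomial_functions.const
            polynomial_functions_digit_monomial poly)
      moreover have "?h (\<psi> y) = 0" for y
        using fun_cong[OF c, of y] by (simp add: sum_fun F_def)
      \<comment> \<open>By density, a relation that holds after pullback holds on
        \<open>Z m\<close>.\<close>
      ultimately have relation: "?h x = 0" if "x \<in> Z m" for x
        using dense that zero_on_zariski_closure_iff[of ?h C "range \<psi>"] by blast
      then show "c e = 0"
        using e digit_monomials_independent
          [where m = m and Z = Z and f = f and D = D and c = c, OF prime sub poly vanish nonzero relation]
        by simp
    qed (simp_all add: finite_sequence_monomials)
    also have "\<dots> \<le> Suc (m * (D * d')) ^ n"
      by (rule card_sequence_monomials)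
    finally show ?thesis
      by (simp add: K_def mult_ac)
  qed
  \<comment> \<open>Cancelling \<open>D ^ n\<close> in the inequality below leaves
    \<open>D \<le> Suc K ^ n\<close>, so one more than this bound is contradictory.\<close>
  define D where "D = Suc (Suc K ^ n)"
  have "D * D ^ n = D ^ Suc n"
    by simp
  also have "\<dots> \<le> D ^ m"
    using \<open>\<not> m \<le> n\<close> by (intro power_increasing) (auto simp: D_def)
  also have "\<dots> \<le> Suc (D * K) ^ n"
    by (rule bound)
  also have "\<dots> \<le> (D * Suc K) ^ n"
    by (intro power_mono) (auto simp: D_def)
  also have "\<dots> = Suc K ^ n * D ^ n"
    by (simp only: power_mult_distrib mult.commute)
  finally have "D \<le> Suc K ^ n"
    by (simp add: D_def)
  then show False
    by (simp add: D_def)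
qed

text \<open>The last two assumptions say that the coordinate subspaces of the parameter space have images
  with strictly increasing closures.\<close>

lemma krull_dim_of_parametrization:
  fixes \<psi> :: "(nat \<Rightarrow> 'k::field) \<Rightarrow> 'x"
  assumes inf: "infinite (UNIV :: 'k set)"
    and coords: "\<And>c. c \<in> C \<Longrightarrow> (\<lambda>y. c (\<psi> y)) \<in> polynomial_functions (sequence_coordinates n)"
    and f: "\<And>j. j < n \<Longrightarrow> f j \<in> polynomial_functions C"
    and vanish: "\<And>j y. j < n \<Longrightarrow> (\<And>i. j \<le> i \<Longrightarrow> y i = 0) \<Longrightarrow> f j (\<psi> y) = 0"
    and nonzero: "\<And>j. j < n \<Longrightarrow> \<exists>y. (\<forall>i>j. y i = 0) \<and> f j (\<psi> y) \<noteq> 0"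
  defines "Y \<equiv> zariski_closure C (range \<psi>)"
  shows "irreducible_space (subtopology (zariski_topology C) Y)"
    and "krull_dim (subtopology (zariski_topology C) Y) = enat n"
proof -
  let ?X = "subtopology (zariski_topology C) Y"
  define W where "W j = \<psi> ` {y. \<forall>i\<ge>j. y i = 0}" for j
  define V where "V j = zariski_closure C (W j)" for j
  have V_prime: "zariski_prime C (V j)" for j
    unfolding V_def W_def using coords
    by (intro zariski_prime_closure zariski_prime_image[OF zariski_prime_initial_sequences[OF inf]])
  have Y_eq: "Y = V n"
  proof
    show "V n \<subseteq> Y"
      unfolding V_def Y_def W_def by (intro zariski_closure_mono) auto
    have "g (\<psi> y) = 0" if g: "g \<in> polynomial_functions C" and zero: "\<And>x. x \<in> W n \<Longrightarrow> g x = 0" for g y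
    proof -
      \<comment> \<open>Polynomial functions in the first \<open>n\<close> coordinates ignore the
        later entries, so truncation changes no value and lands in the subspace defining
        \<open>W n\<close>.\<close>
      define z where "z i = (if i < n then y i else 0)" for i
      have "h y = h z" if "h \<in> polynomial_functions (sequence_coordinates n)" for h
        using that by induction (auto simp: z_def)
      from this[OF polynomial_functions_compose[OF g coords]] have "g (\<psi> y) = g (\<psi> z)" .
      also have "\<dots> = 0"
        by (intro zero) (auto simp: W_def z_def)
      finally show ?thesis .
    qed
    then show "Y \<subseteq> V n"
      unfolding V_def Y_def zariski_closure_def zero_locus_def by auto
  qed
  show "irreducible_space ?X"
    unfolding irreducible_space_zariski_iff Y_eq by (rule V_prime)
  have Y_closed: "closedin (zariski_topology C) Y"
    unfolding Y_def by (rule closedin_zariski_closure)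
  have closed_iff: "closedin ?X Z \<longleftrightarrow> closedin (zariski_topology C) Z \<and> Z \<subseteq> Y" for Z
    by (rule closedin_closed_subtopology[OF Y_closed])
  have irreducible_iff: "irreducible_space (subtopology ?X Z) \<longleftrightarrow> zariski_prime C Z" if "Z \<subseteq> Y" for Z
    using that by (simp add: subtopology_subtopology Int_absorb1 irreducible_space_zariski_iff)
  define chain where "chain Z m \<longleftrightarrow>
      (\<forall>i\<le>m. closedin ?X (Z i) \<and> irreducible_space (subtopology ?X (Z i))) \<and>
      (\<forall>i<m. Z i \<subset> Z (Suc i))" for Z :: "nat \<Rightarrow> 'x set" and m
  have "m \<le> n" if "chain Z m" for Z m
  proof -
    have in_chain: "closedin ?X (Z i)" "irreducible_space (subtopology ?X (Z i))" if "i \<le> m" for i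
      using \<open>chain Z m\<close> that by (simp_all add: chain_def)
    have closed: "closedin (zariski_topology C) (Z i)" and in_Y: "Z i \<subseteq> Y" if "i \<le> m" for i
      using in_chain(1)[OF that] by (simp_all add: closed_iff)
    have prime: "zariski_prime C (Z i)" if "i \<le> m" for i
      using in_chain(2)[OF that] irreducible_iff[OF in_Y[OF that]] by simp
    have sub: "Z i \<subset> Z (Suc i)" if "i < m" for i
      using \<open>chain Z m\<close> that by (simp add: chain_def)
    \<comment> \<open>A point of \<open>Z (Suc i)\<close> outside the closed set \<open>Z i\<close>
      violates one of the equations of \<open>Z i\<close>.\<close>
    have "\<exists>g\<in>polynomial_functions C. (\<forall>x\<in>Z i. g x = 0) \<and> (\<exists>x\<in>Z (Suc i). g x \<noteq> 0)"
      if "i < m" for i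
    proof -
      obtain S where S: "S \<subseteq> polynomial_functions C" "Z i = zero_locus S"
        using closed[of i] \<open>i < m\<close> unfolding closedin_zariski by auto
      obtain x where "x \<in> Z (Suc i)" "x \<notin> Z i"
        using sub[OF \<open>i < m\<close>] by blast
      then obtain g where "g \<in> S" "g x \<noteq> 0"
        unfolding S(2) zero_locus_def by blast
      then show ?thesis
        using S \<open>x \<in> Z (Suc i)\<close> by (intro bexI[of _ g]) (auto simp: zero_locus_def)
    qed
    then obtain g where "\<And>i. i < m \<Longrightarrow> g i \<in> polynomial_functions C \<and>
        (\<forall>x\<in>Z i. g i x = 0) \<and> (\<exists>x\<in>Z (Suc i). g i x \<noteq> 0)"
      by metis
    then show ?thesis
      using sub in_Y[of m] prime unfolding Y_def
      by (intro chain_length_le[OF coords, where m = m and Z = Z and f = g]) auto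
  qed
  moreover have "chain V n"
    unfolding chain_def
  proof (intro conjI allI impI)
    fix i assume "i \<le> n"
    then have "V i \<subseteq> Y"
      unfolding Y_eq V_def W_def by (intro zariski_closure_mono image_mono) auto
    then show "closedin ?X (V i)" "irreducible_space (subtopology ?X (V i))"
      using closed_iff irreducible_iff V_prime closedin_zariski_closure[of C "W i"]
      by (auto simp: V_def)
  next
    fix i assume "i < n"
    have "V i \<subseteq> V (Suc i)"
      unfolding V_def W_def by (intro zariski_closure_mono image_mono) auto
    moreover have "\<forall>x\<in>V i. f i x = 0"
      unfolding V_def zero_on_zariski_closure_iff[OF f[OF \<open>i < n\<close>]] W_def
      using vanish[OF \<open>i < n\<close>] by auto
    moreover have "\<not> (\<forall>x\<in>V (Suc i). f i x = 0)"
      unfolding V_def zero_on_zariski_closure_iff[OF f[OF \<open>i < n\<close>]] W_def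
      using nonzero[OF \<open>i < n\<close>] by (auto simp: Suc_le_eq)
    ultimately show "V i \<subset> V (Suc i)"
      by auto
  qed
  ultimately show "krull_dim ?X = enat n"
    unfolding krull_dim_def chain_def[symmetric]
    by (intro antisym Sup_least Sup_upper) auto
qed

section \<open>Commuting nilpotent matrices\<close>

lemma mat3_eq_iff:
  "A = B \<longleftrightarrow> A $ 1 $ 1 = B $ 1 $ 1 \<and> A $ 1 $ 2 = B $ 1 $ 2 \<and> A $ 1 $ 3 = B $ 1 $ 3 \<and>
    A $ 2 $ 1 = B $ 2 $ 1 \<and> A $ 2 $ 2 = B $ 2 $ 2 \<and> A $ 2 $ 3 = B $ 2 $ 3 \<and>
    A $ 3 $ 1 = B $ 3 $ 1 \<and> A $ 3 $ 2 = B $ 3 $ 2 \<and> A $ 3 $ 3 = B $ 3 $ 3"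
  for A B :: "'k^3^3"
  by (auto simp: vec_eq_iff forall_3)

lemma matrix_mult_3: "(A ** B) $ i $ j = A $ i $ 1 * B $ 1 $ j + A $ i $ 2 * B $ 2 $ j + A $ i $ 3 * B $ 3 $ j"
  for A B :: "'k::semiring_1^3^3"
  by (simp add: matrix_matrix_mult_def sum_3)

definition matrix_3 :: "'k \<Rightarrow> 'k \<Rightarrow> 'k \<Rightarrow> 'k \<Rightarrow> 'k \<Rightarrow> 'k \<Rightarrow> 'k \<Rightarrow> 'k \<Rightarrow> 'k \<Rightarrow> 'k::zero^3^3" where
  "matrix_3 a b c d e f g h i = vector [vector [a, b, c], vector [d, e, f], vector [g, h, i]]"

lemma matrix_3_nth [simp]:
  "matrix_3 a b c d e f g h i $ 1 $ 1 = a"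
  "matrix_3 a b c d e f g h i $ 1 $ 2 = b"
  "matrix_3 a b c d e f g h i $ 1 $ 3 = c"
  "matrix_3 a b c d e f g h i $ 2 $ 1 = d"
  "matrix_3 a b c d e f g h i $ 2 $ 2 = e"
  "matrix_3 a b c d e f g h i $ 2 $ 3 = f"
  "matrix_3 a b c d e f g h i $ 3 $ 1 = g"
  "matrix_3 a b c d e f g h i $ 3 $ 2 = h"
  "matrix_3 a b c d e f g h i $ 3 $ 3 = i"
  by (simp_all add: matrix_3_def)

definition strict_upper :: "'k \<Rightarrow> 'k \<Rightarrow> 'k \<Rightarrow> 'k::zero^3^3" where
  "strict_upper a b c = matrix_3 0 a b 0 0 c 0 0 0"

text \<open>Stands in for the inverse matrix, which it equals for determinant one, and is polynomial
  in the entries.\<close>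

definition adjugate_3 :: "'k::comm_ring_1^3^3 \<Rightarrow> 'k^3^3" where
  "adjugate_3 A = matrix_3
     (A$2$2 * A$3$3 - A$2$3 * A$3$2) (A$1$3 * A$3$2 - A$1$2 * A$3$3) (A$1$2 * A$2$3 - A$1$3 * A$2$2)
     (A$2$3 * A$3$1 - A$2$1 * A$3$3) (A$1$1 * A$3$3 - A$1$3 * A$3$1) (A$1$3 * A$2$1 - A$1$1 * A$2$3)
     (A$2$1 * A$3$2 - A$2$2 * A$3$1) (A$1$2 * A$3$1 - A$1$1 * A$3$2) (A$1$1 * A$2$2 - A$1$2 * A$2$1)"

lemma matrix_mult_adjugate_3:
  "A ** adjugate_3 A = mat (det A)" "adjugate_3 A ** A = mat (det A)"
  by (simp_all add: mat3_eq_iff matrix_mult_3 adjugate_3_def mat_def det_3 algebra_simps)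

text \<open>Only the corner entry survives, so two such matrices commute exactly when
  \<open>a * c' = a' * c\<close>.\<close>

lemma strict_upper_mult:
  "strict_upper a b c ** strict_upper a' b' c' = strict_upper 0 (a * c') (0 :: 'k::comm_ring_1)"
  by (simp add: mat3_eq_iff matrix_mult_3 strict_upper_def)

section \<open>Matrix powers and nilpotency\<close>

abbreviation matrix_power :: "'k::semiring_1^'n^'n \<Rightarrow> nat \<Rightarrow> 'k^'n^'n" where
  "matrix_power A m \<equiv> ((\<lambda>B. A ** B) ^^ m) (mat 1)"

lemma matrix_power_commute:
  assumes "A ** B = B ** A"
  shows "matrix_power A m ** B = B ** matrix_power A m"
  by (induction m) (simp_all, metis assms matrix_mul_assoc)

lemma transpose_matrix_power:
  fixes A :: "'k::comm_semiring_1^'n^'n"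
  shows "matrix_power (transpose A) m = transpose (matrix_power A m)"
  by (induction m)
     (simp_all add: transpose_mat matrix_transpose_mul[symmetric] matrix_power_commute)

lemma nilpotent_matrix_transpose:
  fixes A :: "'k::comm_semiring_1^'n^'n"
  shows "nilpotent_matrix A \<Longrightarrow> nilpotent_matrix (transpose A)"
  unfolding nilpotent_matrix_def transpose_matrix_power
  by (auto simp: transpose_def vec_eq_iff)

lemma matrix_power_conjugate:
  assumes "G ** H = mat 1" "H ** G = mat 1"
  shows "matrix_power (G ** A ** H) m = G ** matrix_power A m ** H"
proof (induction m)
  case (Suc m)
  have "matrix_power (G ** A ** H) (Suc m) = G ** A ** (H ** G) ** matrix_power A m ** H"
    by (simp add: Suc matrix_mul_assoc)
  then show ?case
    by (simp add: assms(2) matrix_mul_assoc)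
qed (simp add: assms(1))

lemma matrix_mult_zero [simp]:
  "A ** (0 :: 'k::semiring_1^'n^'m) = 0" "(0 :: 'k^'n^'m) ** B = 0"
  by (simp_all add: matrix_matrix_mult_def vec_eq_iff)

lemma nilpotent_matrix_conjugate:
  fixes A :: "'k::comm_ring_1^'n^'n"
  assumes "G ** H = mat 1" "H ** G = mat 1" "nilpotent_matrix A"
  shows "nilpotent_matrix (G ** A ** H)"
proof -
  obtain m where "matrix_power A m = 0"
    using assms(3) unfolding nilpotent_matrix_def by blast
  then show ?thesis
    unfolding nilpotent_matrix_def matrix_power_conjugate[OF assms(1,2)]
    by (intro exI[of _ m]) simp
qed

text \<open>Matrices are added one at a time: the last nonzero iterate of the new matrix on a common
  kernel vector of the old ones is killed by all, as they commute. \<open>Q\<close> keeps the vector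
  inside a prescribed invariant set.\<close>

lemma common_kernel_vector:
  fixes v :: "'r::finite \<Rightarrow> 'k::comm_ring_1^'n^'n"
  assumes commute: "\<And>i j. v i ** v j = v j ** v i"
    and nilpotent: "\<And>i. nilpotent_matrix (v i)"
    and invariant: "\<And>i y. Q y \<Longrightarrow> Q (v i *v y)"
    and start: "y \<noteq> 0" "Q y"
  shows "\<exists>x. x \<noteq> 0 \<and> Q x \<and> (\<forall>i. v i *v x = 0)"
proof -
  have "\<exists>x. x \<noteq> 0 \<and> Q x \<and> (\<forall>i\<in>I. v i *v x = 0)" for I :: "'r set"
    using finite[of I]
  proof (induction I rule: finite_induct)
    case empty
    then show ?case using start by auto
  next
    case (insert j I)
    then obtain x where x: "x \<noteq> 0" "Q x" "\<forall>i\<in>I. v i *v x = 0" by blast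
    define w where "w m = matrix_power (v j) m *v x" for m
    have w_Suc: "w (Suc m) = v j *v w m" for m
      by (simp add: w_def matrix_vector_mul_assoc)
    have w_Q: "Q (w m)" for m
      by (induction m) (auto simp: w_Suc invariant, simp add: w_def x(2))
    have w_ker: "v i *v w m = 0" if "i \<in> I" for i m
      using x(3) that matrix_power_commute[OF commute[of j i], of m]
      by (metis w_def matrix_vector_mul_assoc matrix_vector_mult_0_right)
    have "\<exists>m. w m = 0"
      using nilpotent[of j] unfolding nilpotent_matrix_def w_def by (metis matrix_vector_mult_0)
    moreover have "w 0 \<noteq> 0"
      using x(1) by (simp add: w_def)
    ultimately obtain m where "w m \<noteq> 0" "w (Suc m) = 0"
      using ex_least_nat_less[of "\<lambda>m. w m = 0"] by (metis order_refl)
    then show ?case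
      using w_Q w_ker by (intro exI[of _ "w m"]) (auto simp: w_Suc)
  qed
  from this[of UNIV] show ?thesis by simp
qed

text \<open>A linear form \<phi> killing all images and a common kernel vector \<open>x\<close> in
  its kernel give the flag of a line in a plane. In an adapted basis the first column and last row
  vanish, and nilpotency removes the middle entry.\<close>

lemma commuting_nilpotent_triangular:
  fixes v :: "'r::finite \<Rightarrow> 'k::field^3^3"
  assumes commute: "\<And>i j. v i ** v j = v j ** v i"
    and nilpotent: "\<And>i. nilpotent_matrix (v i)"
  shows "\<exists>G a b c. det G = 1 \<and> (\<forall>i. v i = G ** strict_upper (a i) (b i) (c i) ** adjugate_3 G)"
proof -
  \<comment> \<open>The form comes from a common kernel vector of the transposes; the trivial
    predicate imposes no constraint.\<close>
  have "\<exists>\<phi>. \<phi> \<noteq> 0 \<and> True \<and> (\<forall>i. transpose (v i) *v \<phi> = 0)"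
    by (rule common_kernel_vector[where y = "\<chi> i. 1"])
       (auto simp: nilpotent nilpotent_matrix_transpose vec_eq_iff commute
         simp flip: matrix_transpose_mul)
  then obtain \<phi> where \<phi>: "\<phi> \<noteq> 0" "\<And>i. transpose (v i) *v \<phi> = 0"
    by blast
  define Q where "Q y \<longleftrightarrow> \<phi>$1 * y$1 + \<phi>$2 * y$2 + \<phi>$3 * y$3 = 0" for y :: "'k^3"
  have row: "v i $ 1 $ k * \<phi> $ 1 + v i $ 2 $ k * \<phi> $ 2 + v i $ 3 $ k * \<phi> $ 3 = 0" for i k
    using arg_cong[OF \<phi>(2)[of i], of "\<lambda>u. u $ k"]
    by (simp add: matrix_vector_mult_def transpose_def sum_3)
  have image: "Q (v i *v y)" for i y
  proof -
    have "\<phi>$1 * (v i *v y)$1 + \<phi>$2 * (v i *v y)$2 + \<phi>$3 * (v i *v y)$3 =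
      (v i $ 1 $ 1 * \<phi> $ 1 + v i $ 2 $ 1 * \<phi> $ 2 + v i $ 3 $ 1 * \<phi> $ 3) * y $ 1 +
      (v i $ 1 $ 2 * \<phi> $ 1 + v i $ 2 $ 2 * \<phi> $ 2 + v i $ 3 $ 2 * \<phi> $ 3) * y $ 2 +
      (v i $ 1 $ 3 * \<phi> $ 1 + v i $ 2 $ 3 * \<phi> $ 2 + v i $ 3 $ 3 * \<phi> $ 3) * y $ 3"
      by (simp add: matrix_vector_mult_def sum_3 algebra_simps)
    then show ?thesis
      by (simp add: Q_def row)
  qed
  obtain y0 where "y0 \<noteq> 0" "Q y0"
  proof (cases "\<phi>$1 = 0 \<and> \<phi>$2 = 0")
    case True
    then show ?thesis
      by (intro that[of "vector [1, 0, 0]"]) (auto simp: Q_def vec_eq_iff forall_3)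
  next
    case False
    then show ?thesis
      by (intro that[of "vector [\<phi>$2, - \<phi>$1, 0]"]) (auto simp: Q_def vec_eq_iff forall_3)
  qed
  then have "\<exists>x. x \<noteq> 0 \<and> Q x \<and> (\<forall>i. v i *v x = 0)"
    by (intro common_kernel_vector[where y = y0] commute nilpotent image)
  then obtain x where x: "x \<noteq> 0" "Q x" "\<And>i. v i *v x = 0"
    by blast
  have Qx: "\<phi>$1 * x$1 + \<phi>$2 * x$2 + \<phi>$3 * x$3 = 0"
    using x(2) by (simp add: Q_def)
  \<comment> \<open>A vector \<open>y\<close> whose cross product \<open>x \<times> y\<close> is
    \<phi>, which exists because \<phi> is orthogonal to \<open>x\<close>. It makes \<phi> the last
    row of the adjugate of \<open>G\<close>, and the determinant of \<open>G\<close> the value of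
    \<phi> at \<open>z\<close>.\<close>
  have "\<exists>y1 y2 y3. x$2 * y3 - x$3 * y2 = \<phi>$1 \<and> x$3 * y1 - x$1 * y3 = \<phi>$2 \<and>
      x$1 * y2 - x$2 * y1 = \<phi>$3"
  proof -
    consider "x$1 \<noteq> 0" | "x$2 \<noteq> 0" | "x$3 \<noteq> 0"
      using x(1) by (auto simp: vec_eq_iff forall_3)
    then show ?thesis
    proof cases
      case 1
      have eq: "\<phi>$1 * x$1 = - (\<phi>$2 * x$2) - \<phi>$3 * x$3"
        using Qx by algebra
      show ?thesis
        by (rule exI[of _ 0], rule exI[of _ "\<phi>$3 / x$1"], rule exI[of _ "- \<phi>$2 / x$1"],
            use 1 eq in \<open>simp add: field_simps; algebra\<close>)
    next
      case 2
      have eq: "\<phi>$2 * x$2 = - (\<phi>$1 * x$1) - \<phi>$3 * x$3"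
        using Qx by algebra
      show ?thesis
        by (rule exI[of _ "- \<phi>$3 / x$2"], rule exI[of _ 0], rule exI[of _ "\<phi>$1 / x$2"],
            use 2 eq in \<open>simp add: field_simps; algebra\<close>)
    next
      case 3
      have eq: "\<phi>$3 * x$3 = - (\<phi>$1 * x$1) - \<phi>$2 * x$2"
        using Qx by algebra
      show ?thesis
        by (rule exI[of _ "\<phi>$2 / x$3"], rule exI[of _ "- \<phi>$1 / x$3"], rule exI[of _ 0],
            use 3 eq in \<open>simp add: field_simps; algebra\<close>)
    qed
  qed
  then obtain y1 y2 y3 where y: "x$2 * y3 - x$3 * y2 = \<phi>$1" "x$3 * y1 - x$1 * y3 = \<phi>$2"
      "x$1 * y2 - x$2 * y1 = \<phi>$3"
    by blast
  have "\<exists>z1 z2 z3. \<phi>$1 * z1 + \<phi>$2 * z2 + \<phi>$3 * z3 = 1"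
  proof -
    consider "\<phi>$1 \<noteq> 0" | "\<phi>$2 \<noteq> 0" | "\<phi>$3 \<noteq> 0"
      using \<phi>(1) by (auto simp: vec_eq_iff forall_3)
    then show ?thesis
    proof cases
      case 1
      show ?thesis by (rule exI[of _ "1 / \<phi>$1"], intro exI[of _ 0], use 1 in simp)
    next
      case 2
      show ?thesis by (rule exI[of _ 0], rule exI[of _ "1 / \<phi>$2"], rule exI[of _ 0], use 2 in simp)
    next
      case 3
      show ?thesis by (rule exI[of _ 0], rule exI[of _ 0], rule exI[of _ "1 / \<phi>$3"], use 3 in simp)
    qed
  qed
  then obtain z1 z2 z3 where z: "\<phi>$1 * z1 + \<phi>$2 * z2 + \<phi>$3 * z3 = 1"
    by blast
  define G where "G = matrix_3 (x$1) y1 z1 (x$2) y2 z2 (x$3) y3 z3"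
  define H where "H = adjugate_3 G"
  have "det G = (x$2 * y3 - x$3 * y2) * z1 + (x$3 * y1 - x$1 * y3) * z2 + (x$1 * y2 - x$2 * y1) * z3"
    by (simp add: G_def det_3 algebra_simps)
  then have det_G: "det G = 1"
    using y z by simp
  have GH: "G ** H = mat 1" and HG: "H ** G = mat 1"
    using matrix_mult_adjugate_3[of G] by (simp_all add: H_def det_G)
  have H_row: "H $ 3 $ 1 = \<phi> $ 1" "H $ 3 $ 2 = \<phi> $ 2" "H $ 3 $ 3 = \<phi> $ 3"
    using y by (simp_all add: H_def G_def adjugate_3_def algebra_simps)
  define n where "n i = H ** v i ** G" for i
  have v_eq: "v i = G ** n i ** H" for i
  proof -
    have "G ** n i ** H = (G ** H) ** v i ** (G ** H)"
      by (simp add: n_def matrix_mul_assoc)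
    then show ?thesis
      by (simp add: GH)
  qed
  have col1: "n i $ k $ 1 = 0" for i k
  proof -
    have "(v i ** G) $ l $ 1 = (v i *v x) $ l" for l
      by (simp add: matrix_mult_3 matrix_vector_mult_def sum_3 G_def)
    then have "(H ** (v i ** G)) $ k $ 1 = 0"
      by (simp add: matrix_mult_3[of H] x(3))
    then show ?thesis
      by (simp add: n_def matrix_mul_assoc)
  qed
  have row3: "n i $ 3 $ k = 0" for i k
  proof -
    have "(H ** v i) $ 3 $ l = 0" for l
      using row[of i l] by (simp add: matrix_mult_3 H_row mult.commute)
    then show ?thesis
      by (simp add: n_def matrix_mult_3[of "H ** v i"])
  qed
  have n22: "n i $ 2 $ 2 = 0" for i
  proof -
    have "nilpotent_matrix (n i)"
      unfolding n_def by (intro nilpotent_matrix_conjugate HG GH nilpotent)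
    then obtain m where m: "matrix_power (n i) m = 0"
      unfolding nilpotent_matrix_def by blast
    \<comment> \<open>With zero first column and last row, the middle entry of a power is the power
      of the middle entry.\<close>
    have "matrix_power (n i) m $ 2 $ 2 = n i $ 2 $ 2 ^ m \<and> matrix_power (n i) m $ 3 $ 2 = 0" for m
      by (induction m) (simp_all add: mat_def matrix_mult_3 col1 row3)
    from this[of m] show ?thesis
      by (simp add: m)
  qed
  have "n i = strict_upper (n i $ 1 $ 2) (n i $ 1 $ 3) (n i $ 2 $ 3)" for i
    by (simp add: mat3_eq_iff strict_upper_def col1 row3 n22)
  then have "\<forall>i. v i = G ** strict_upper (n i $ 1 $ 2) (n i $ 1 $ 3) (n i $ 2 $ 3) ** adjugate_3 G"
    using v_eq by (simp flip: H_def)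
  with det_G have "det G = 1 \<and>
      (\<forall>i. v i = G ** strict_upper (n i $ 1 $ 2) (n i $ 1 $ 3) (n i $ 2 $ 3) ** adjugate_3 G)"
    by simp
  then show ?thesis
    by (intro exI)
qed

text \<open>The two rows \<open>a\<close> and \<open>c\<close> have rank at most one. Two factors
  \<open>s\<close> and \<open>t\<close> are kept to include the case \<open>a = 0\<close>.\<close>

lemma proportional_families:
  fixes a c :: "'r \<Rightarrow> 'k::field"
  assumes "\<And>i j. a i * c j = a j * c i"
  shows "\<exists>s t l. \<forall>i. a i = s * l i \<and> c i = t * l i"
proof (cases "\<exists>i. a i \<noteq> 0")
  case True
  then obtain i where "a i \<noteq> 0" by blast
  then have "\<forall>j. a j = 1 * a j \<and> c j = c i / a i * a j"
    using assms by (auto simp: field_simps)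
  then show ?thesis by blast
next
  case False
  then have "\<forall>i. a i = 0 * c i \<and> c i = 1 * c i"
    by simp
  then show ?thesis by blast
qed

text \<open>Turns nilpotency into polynomial equations, by triangularizing the one-element family of
  \<open>A\<close>.\<close>

lemma nilpotent_matrix_3_cube:
  fixes A :: "'k::field^3^3"
  shows "nilpotent_matrix A \<longleftrightarrow> A ** (A ** A) = 0"
proof
  assume "nilpotent_matrix A"
  then obtain G a b c where G: "det G = 1" "A = G ** strict_upper a b c ** adjugate_3 G"
    using commuting_nilpotent_triangular[of "\<lambda>_ :: unit. A"] by auto
  have inv: "G ** adjugate_3 G = mat 1" "adjugate_3 G ** G = mat 1"
    using matrix_mult_adjugate_3[of G] G(1) by simp_all
  have "A ** (A ** A) = matrix_power A 3"
    by (simp add: numeral_3_eq_3)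
  also have "\<dots> = G ** matrix_power (strict_upper a b c) 3 ** adjugate_3 G"
    unfolding G(2) by (rule matrix_power_conjugate[OF inv])
  also have "matrix_power (strict_upper a b c) 3 = 0"
    by (simp add: numeral_3_eq_3 strict_upper_mult) (simp add: strict_upper_def mat3_eq_iff)
  finally show "A ** (A ** A) = 0"
    by simp
next
  assume "A ** (A ** A) = 0"
  then show "nilpotent_matrix A"
    unfolding nilpotent_matrix_def by (intro exI[of _ 3]) (simp add: numeral_3_eq_3)
qed

lemma closedin_commuting_variety_nilpotent_cone:
  "closedin zariski_matrix_tuples (commuting_variety nilpotent_cone :: ('k::field^3^3^'r) set)"
proof -
  define S :: "('k^3^3^'r \<Rightarrow> 'k) set" where
    "S = range (\<lambda>i v. trace (v $ i)) \<union>
      (\<lambda>(i, a, b) v. (v $ i ** (v $ i ** v $ i)) $ a $ b) ` UNIV \<union>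
      (\<lambda>(i, j, a, b) v. lie_bracket (v $ i) (v $ j) $ a $ b) ` UNIV"
  have entry: "(\<lambda>v. v $ i $ a $ b) \<in> polynomial_functions matrix_tuple_coordinates" for i a b
    by (intro polynomial_functions.coord) (auto simp: matrix_tuple_coordinates_def)
  have "S \<subseteq> polynomial_functions matrix_tuple_coordinates"
    by (auto simp: S_def trace_def lie_bracket_def
        intro!: polynomial_functions_sum polynomial_functions_diff polynomial_functions_matrix_mult entry)
  moreover have "commuting_variety nilpotent_cone = zero_locus S"
    unfolding S_def zero_locus_def commuting_variety_def nilpotent_cone_def sl_def nilpotent_matrix_3_cube
    by (auto simp: ball_Un vec_eq_iff)
  ultimately show ?thesis
    unfolding closedin_zariski by blast
qed

section \<open>Parametrization of the commuting variety\<close>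

text \<open>As the adjugate inverts \<open>G\<close>, trace, nilpotency and products can be computed
  on the strictly upper triangular tuple.\<close>

lemma triangular_tuple_in_commuting_variety:
  fixes v :: "'k::comm_ring_1^3^3^'r"
  assumes G: "det G = 1"
    and v: "\<And>i. v $ i = G ** strict_upper (a i) (b i) (c i) ** adjugate_3 G"
    and ac: "\<And>i j. a i * c j = a j * c i"
  shows "v \<in> commuting_variety nilpotent_cone"
proof -
  have inv: "G ** adjugate_3 G = mat 1" "adjugate_3 G ** G = mat 1"
    using matrix_mult_adjugate_3[of G] G by simp_all
  have "v $ i \<in> nilpotent_cone" for i
  proof -
    have "trace (v $ i) = trace (adjugate_3 G ** G ** strict_upper (a i) (b i) (c i))"
      unfolding v by (subst trace_mul_sym) (simp add: matrix_mul_assoc)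
    also have "\<dots> = 0"
      by (simp add: inv trace_def sum_3 strict_upper_def)
    finally have "trace (v $ i) = 0" .
    moreover have "matrix_power (strict_upper (a i) (b i) (c i)) 3 = 0"
      by (simp add: numeral_3_eq_3 strict_upper_mult) (simp add: strict_upper_def mat3_eq_iff)
    then have "nilpotent_matrix (v $ i)"
      unfolding v by (intro nilpotent_matrix_conjugate inv) (auto simp: nilpotent_matrix_def)
    ultimately show ?thesis
      by (simp add: nilpotent_cone_def sl_def)
  qed
  moreover have "v $ i ** v $ j = G ** strict_upper 0 (a i * c j) 0 ** adjugate_3 G" for i j
  proof -
    have "v $ i ** v $ j = G ** strict_upper (a i) (b i) (c i) ** (adjugate_3 G ** G) **
        strict_upper (a j) (b j) (c j) ** adjugate_3 G"
      by (simp add: v matrix_mul_assoc)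
    also have "\<dots> = G ** (strict_upper (a i) (b i) (c i) ** strict_upper (a j) (b j) (c j)) ** adjugate_3 G"
      by (simp add: inv matrix_mul_assoc)
    finally show ?thesis
      by (simp add: strict_upper_mult)
  qed
  ultimately show ?thesis
    unfolding commuting_variety_def lie_bracket_def using ac by simp
qed

text \<open>Coordinates of the big cell of the flag variety; \<open>u\<close> sits at position (3,2)
  and \<open>q\<close> at (3,1).\<close>

abbreviation lower_unitriangular :: "'k \<Rightarrow> 'k \<Rightarrow> 'k \<Rightarrow> 'k::{zero,one}^3^3" where
  "lower_unitriangular p u q \<equiv> matrix_3 1 0 0 p 1 0 q u 1"

lemma lower_unitriangular_conjugate_strict_upper:
  fixes p u q a b c :: "'k::comm_ring_1"
  shows "lower_unitriangular p u q ** strict_upper a b c ** adjugate_3 (lower_unitriangular p u q) =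
    matrix_3
      (b * (p * u - q) - p * a) (a - u * b) b
      (p * (b * (p * u - q) - p * a) + c * (p * u - q)) (p * (a - u * b) - u * c) (p * b + c)
      (q * (b * (p * u - q) - p * a) + u * c * (p * u - q)) (q * (a - u * b) - u * (u * c)) (q * b + u * c)"
  by (simp add: mat3_eq_iff matrix_mult_3 strict_upper_def adjugate_3_def algebra_simps)

text \<open>The hypothesis on \<open>G\<close> is the factorization of \<open>G\<close> into a lower unitriangular and an upper
  triangular matrix; the latter normalizes the strictly upper triangular matrices.\<close>

lemma conjugate_strict_upper_factorization:
  fixes x1 :: "'k::comm_ring_1"
  assumes "G = matrix_3 x1 y1 z1 (p * x1) (p * y1 + \<eta>) z2 (q * x1) (q * y1 + u * \<eta>) z3"
  defines "\<rho> \<equiv> x1 * (z3 - q * z1 + u * (p * z1 - z2))"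
  shows "G ** strict_upper a b c ** adjugate_3 G =
      lower_unitriangular p u q **
      strict_upper (a * x1 * \<rho>) (x1 * (a * x1 * (p * z1 - z2) + (c * y1 + b * x1) * \<eta>)) (c * x1 * \<eta> * \<eta>) **
      adjugate_3 (lower_unitriangular p u q)"
    and "det G = \<eta> * \<rho>"
  unfolding lower_unitriangular_conjugate_strict_upper assms
  by (simp_all add: mat3_eq_iff matrix_mult_3 strict_upper_def adjugate_3_def det_3 algebra_simps)

text \<open>Nonzero leading minors give the triangular factorization, and
  \<open>s \<noteq> 0\<close> keeps the ratio finite. The adjugate is the inverse only up to the
  scalar \<open>det G\<close>, which the new triangular entries absorb.\<close>

lemma generic_conjugate_strict_upper:
  fixes G :: "'k::field^3^3"
  assumes "s \<noteq> 0" "G$1$1 \<noteq> 0" "G$1$1 * G$2$2 - G$1$2 * G$2$1 \<noteq> 0" "det G \<noteq> 0"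
  shows "\<exists>p u q t' l' b'. \<forall>i. G ** strict_upper (s * l i) (b i) (t * l i) ** adjugate_3 G =
      lower_unitriangular p u q ** strict_upper (l' i) (b' i) (t' * l' i) **
      adjugate_3 (lower_unitriangular p u q)"
proof -
  define p where "p = G$2$1 / G$1$1"
  define q where "q = G$3$1 / G$1$1"
  define \<eta> where "\<eta> = G$2$2 - p * G$1$2"
  define u where "u = (G$3$2 - q * G$1$2) / \<eta>"
  have "\<eta> * G$1$1 = G$1$1 * G$2$2 - G$1$2 * G$2$1"
    using assms(2) by (simp add: \<eta>_def p_def field_simps)
  then have "\<eta> \<noteq> 0"
    using assms(3) by auto
  then have G: "G = matrix_3 (G$1$1) (G$1$2) (G$1$3) (p * G$1$1) (p * G$1$2 + \<eta>) (G$2$3)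
      (q * G$1$1) (q * G$1$2 + u * \<eta>) (G$3$3)"
    using assms(2) by (simp add: mat3_eq_iff p_def q_def u_def) (simp add: \<eta>_def p_def)
  define \<rho> where "\<rho> = G$1$1 * (G$3$3 - q * G$1$3 + u * (p * G$1$3 - G$2$3))"
  note factorization = conjugate_strict_upper_factorization[OF G, folded \<rho>_def]
  have "\<rho> \<noteq> 0"
    using factorization(2) assms(4) by auto
  \<comment> \<open>The quotient of the two transformed superdiagonal entries, in which
    \<open>l i\<close> and the first pivot cancel.\<close>
  define t' where "t' = t * \<eta> * \<eta> / (s * \<rho>)"
  define l' where "l' i = s * l i * G$1$1 * \<rho>" for i
  have c_eq: "t * l i * G$1$1 * \<eta> * \<eta> = t' * l' i" for i
    using \<open>\<rho> \<noteq> 0\<close> assms(1) by (simp add: t'_def l'_def)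
  have "\<forall>i. G ** strict_upper (s * l i) (b i) (t * l i) ** adjugate_3 G =
      lower_unitriangular p u q ** strict_upper (l' i)
        (G$1$1 * (s * l i * G$1$1 * (p * G$1$3 - G$2$3) + (t * l i * G$1$2 + b i * G$1$1) * \<eta>))
        (t' * l' i) ** adjugate_3 (lower_unitriangular p u q)"
    unfolding factorization(1) c_eq by (simp add: l'_def)
  then show ?thesis
    by (intro exI)
qed

section \<open>Polynomiality of conjugated tuples\<close>

lemma polynomial_functions_adjugate_3:
  assumes "\<And>i j. (\<lambda>x. M x $ i $ j) \<in> polynomial_functions C"
  shows "(\<lambda>x. adjugate_3 (M x) $ i $ j) \<in> polynomial_functions C"
  using exhaust_3[of i] exhaust_3[of j]
  by (auto simp: adjugate_3_def intro!: polynomial_functions_intros assms)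

lemma polynomial_functions_strict_upper:
  assumes "a \<in> polynomial_functions C" "b \<in> polynomial_functions C" "c \<in> polynomial_functions C"
  shows "(\<lambda>x. strict_upper (a x) (b x) (c x) $ i $ j) \<in> polynomial_functions C"
  using exhaust_3[of i] exhaust_3[of j]
  by (auto simp: strict_upper_def intro!: polynomial_functions.const assms)

lemma polynomial_functions_conjugate_strict_upper:
  assumes "\<And>i j. (\<lambda>x. M x $ i $ j) \<in> polynomial_functions C"
    and "a \<in> polynomial_functions C" "b \<in> polynomial_functions C" "c \<in> polynomial_functions C"
  shows "(\<lambda>x. (M x ** strict_upper (a x) (b x) (c x) ** adjugate_3 (M x)) $ i $ j)
    \<in> polynomial_functions C"
  by (intro polynomial_functions_matrix_mult polynomial_functions_adjugate_3
      polynomial_functions_strict_upper assms)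

text \<open>A matrix that is not of the generic form is joined to the identity matrix by a line, on which
  all but finitely many matrices are generic.\<close>

lemma commuting_nilpotent_subset_closure:
  fixes U :: "('k::field^3^3^'r::finite) set"
  assumes inf: "infinite (UNIV :: 'k set)"
    and U: "\<And>v p u q t l b. (\<And>i. v $ i = lower_unitriangular p u q **
      strict_upper (l i) (b i) (t * l i) ** adjugate_3 (lower_unitriangular p u q)) \<Longrightarrow> v \<in> U"
  shows "commuting_variety nilpotent_cone \<subseteq> zariski_closure matrix_tuple_coordinates U"
proof
  fix v :: "'k^3^3^'r" assume v: "v \<in> commuting_variety nilpotent_cone"
  have "\<And>i j. v $ i ** v $ j = v $ j ** v $ i" "\<And>i. nilpotent_matrix (v $ i)"
    using v by (auto simp: commuting_variety_def nilpotent_cone_def lie_bracket_def)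
  from commuting_nilpotent_triangular[of "\<lambda>i. v $ i", OF this]
  obtain G a b c where G: "det G = 1"
    and v_eq: "\<And>i. v $ i = G ** strict_upper (a i) (b i) (c i) ** adjugate_3 G"
    by blast
  have inv: "G ** adjugate_3 G = mat 1" "adjugate_3 G ** G = mat 1"
    using matrix_mult_adjugate_3[of G] G by simp_all
  \<comment> \<open>Conjugating back turns commutation into equality of the corner entries.\<close>
  have "a i * c j = a j * c i" for i j
  proof -
    have conj: "adjugate_3 G ** (v $ i ** v $ j) ** G = strict_upper 0 (a i * c j) 0" for i j
    proof -
      have "adjugate_3 G ** (v $ i ** v $ j) ** G = (adjugate_3 G ** G) ** strict_upper (a i) (b i) (c i) **
          (adjugate_3 G ** G) ** strict_upper (a j) (b j) (c j) ** (adjugate_3 G ** G)"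
        by (simp add: v_eq matrix_mul_assoc)
      then show ?thesis
        by (simp add: inv strict_upper_mult)
    qed
    have "strict_upper 0 (a i * c j) 0 = strict_upper 0 (a j * c i) (0 :: 'k)"
      using conj[of i j] conj[of j i] \<open>\<And>i j. v $ i ** v $ j = v $ j ** v $ i\<close> by metis
    then show ?thesis
      by (simp add: mat3_eq_iff strict_upper_def)
  qed
  then obtain s t l where stl: "\<And>i. a i = s * l i" "\<And>i. c i = t * l i"
    using proportional_families[of a c] by blast
  define M where "M \<tau> = (\<chi> i j. G $ i $ j + \<tau> * (mat 1 $ i $ j - G $ i $ j))" for \<tau>
  \<comment> \<open>Moving \<open>s\<close> to 1 along with the matrix also makes the ratio finite
    when all \<open>a i\<close> vanish.\<close>
  define s' where "s' \<tau> = s + \<tau> * (1 - s)" for \<tau>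
  define \<gamma> where "\<gamma> \<tau> = (\<chi> i. M \<tau> ** strict_upper (s' \<tau> * l i) (b i) (t * l i) ** adjugate_3 (M \<tau>))" for \<tau>
  \<comment> \<open>The product of all genericity conditions: the curve \<gamma> lies in
    \<open>U\<close> where it is nonzero.\<close>
  define \<Delta> where "\<Delta> \<tau> = s' \<tau> * (M \<tau> $ 1 $ 1) *
      (M \<tau> $ 1 $ 1 * M \<tau> $ 2 $ 2 - M \<tau> $ 1 $ 2 * M \<tau> $ 2 $ 1) * det (M \<tau>)" for \<tau>
  let ?P = "polynomial_functions {\<lambda>\<tau> :: 'k. \<tau>}"
  have id_poly: "(\<lambda>\<tau>. \<tau>) \<in> ?P"
    by (intro polynomial_functions.coord) simp
  have M_poly: "(\<lambda>\<tau>. M \<tau> $ i $ j) \<in> ?P" for i j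
    unfolding M_def vec_lambda_beta by (intro polynomial_functions_intros id_poly)
  have s_poly: "s' \<in> ?P"
    unfolding s'_def[abs_def] by (intro polynomial_functions_intros id_poly)
  have \<Delta>_poly: "\<Delta> \<in> ?P"
    unfolding \<Delta>_def[abs_def] det_3 by (intro polynomial_functions_intros M_poly s_poly)
  have \<gamma>_poly: "(\<lambda>\<tau>. \<gamma> \<tau> $ i $ j $ k) \<in> ?P" for i j k
    unfolding \<gamma>_def vec_lambda_beta
    by (intro polynomial_functions_conjugate_strict_upper polynomial_functions_intros M_poly s_poly)
  have \<gamma>_U: "\<gamma> \<tau> \<in> U" if "\<Delta> \<tau> \<noteq> 0" for \<tau>
  proof -
    have "\<exists>p u q t' l' b'. \<forall>i. \<gamma> \<tau> $ i =
      lower_unitriangular p u q ** strict_upper (l' i) (b' i) (t' * l' i) **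
      adjugate_3 (lower_unitriangular p u q)"
      unfolding \<gamma>_def vec_lambda_beta using that
      by (intro generic_conjugate_strict_upper) (auto simp: \<Delta>_def)
    then show ?thesis
      using U by blast
  qed
  have "s' 1 = 1" "M 1 = mat 1"
    by (simp_all add: s'_def M_def vec_eq_iff)
  then have "\<Delta> 1 = 1"
    by (simp add: \<Delta>_def mat_def det_3)
  have "s' 0 = s" "M 0 = G"
    by (simp_all add: s'_def M_def vec_eq_iff)
  then have "\<gamma> 0 $ i = v $ i" for i
    by (simp add: \<gamma>_def v_eq stl)
  then have "\<gamma> 0 = v"
    by (simp add: vec_eq_iff[of "\<gamma> 0"])
  have "f v = 0" if f: "f \<in> polynomial_functions matrix_tuple_coordinates" and zero: "\<forall>w\<in>U. f w = 0" for f
  proof -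
    have "(\<lambda>\<tau>. f (\<gamma> \<tau>)) \<in> ?P"
      using f by (rule polynomial_functions_compose)
        (auto simp: matrix_tuple_coordinates_def intro: \<gamma>_poly)
    moreover have "\<Delta> \<tau> * f (\<gamma> \<tau>) = 0" for \<tau>
      using \<gamma>_U zero by (cases "\<Delta> \<tau> = 0") auto
    \<comment> \<open>As \<Delta> is 1 at 1, the function \<open>f\<close> vanishes along the whole
      curve, in particular at \<open>v\<close>, its point at 0.\<close>
    ultimately have "(\<forall>\<tau>. \<Delta> \<tau> = 0) \<or> (\<forall>\<tau>. f (\<gamma> \<tau>) = 0)"
      by (intro polynomial_functions_line_mult_zero[OF inf \<Delta>_poly])
    then show ?thesis
      using \<open>\<Delta> 1 = 1\<close> \<open>\<gamma> 0 = v\<close> by (metis zero_neq_one)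
  qed
  then show "v \<in> zariski_closure matrix_tuple_coordinates U"
    unfolding zariski_closure_def zero_locus_def by blast
qed

text \<open>With \<open>r\<close> the number of matrices, a parameter sequence lists the entries \<open>a\<^sub>i\<close> and \<open>b\<^sub>i\<close>
  (\<open>r\<close> each), the ratio \<open>t = c\<^sub>i / a\<^sub>i\<close>, and the entries \<open>u\<close>, \<open>q\<close>, \<open>p\<close> of the conjugating matrix.\<close>

definition tuple_parametrization :: "('r \<Rightarrow> nat) \<Rightarrow> (nat \<Rightarrow> 'k::comm_ring_1) \<Rightarrow> 'k^3^3^'r::finite" where
  "tuple_parametrization idx y =
     (let r = CARD('r); L = lower_unitriangular (y (2 * r + 3)) (y (2 * r + 1)) (y (2 * r + 2))
      in \<chi> i. L ** strict_upper (y (idx i)) (y (r + idx i)) (y (2 * r) * y (idx i)) ** adjugate_3 L)"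

lemma tuple_parametrization_in_commuting_variety:
  "tuple_parametrization idx y \<in> commuting_variety nilpotent_cone"
  unfolding tuple_parametrization_def Let_def
  by (rule triangular_tuple_in_commuting_variety[OF _ vec_lambda_beta]) (simp_all add: det_3 mult_ac)

lemma commuting_variety_eq_closure_parametrization:
  fixes idx :: "'r::finite \<Rightarrow> nat"
  assumes inf: "infinite (UNIV :: 'k::field set)"
    and idx: "inj idx" "range idx = {..<CARD('r)}"
  shows "(commuting_variety nilpotent_cone :: ('k^3^3^'r) set) =
    zariski_closure matrix_tuple_coordinates (range (tuple_parametrization idx))"
proof
  show "(commuting_variety nilpotent_cone :: ('k^3^3^'r) set) \<subseteq>
    zariski_closure matrix_tuple_coordinates (range (tuple_parametrization idx))"
  proof (rule commuting_nilpotent_subset_closure[OF inf])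
    fix v :: "'k^3^3^'r" and p u q t l b
    assume v: "\<And>i. v $ i = lower_unitriangular p u q **
      strict_upper (l i) (b i) (t * l i) ** adjugate_3 (lower_unitriangular p u q)"
    define r where "r = CARD('r)"
    \<comment> \<open>The final default gives \<open>p\<close> at index \<open>2 * r + 3\<close>;
      the parametrization reads no later entry.\<close>
    define y where "y j = (if j < r then l (inv idx j) else if j < 2 * r then b (inv idx (j - r))
      else if j = 2 * r then t else if j = 2 * r + 1 then u else if j = 2 * r + 2 then q else p)" for j
    have idx_less: "idx i < r" for i
      using idx(2) by (auto simp: r_def)
    have "tuple_parametrization idx y = v"
      using idx_less by (simp add: tuple_parametrization_def Let_def r_def[symmetric] vec_eq_iff v
          y_def inv_f_f[OF idx(1)])
    then show "v \<in> range (tuple_parametrization idx)"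
      by blast
  qed
  show "zariski_closure matrix_tuple_coordinates (range (tuple_parametrization idx)) \<subseteq>
    (commuting_variety nilpotent_cone :: ('k^3^3^'r) set)"
    by (intro zariski_closure_minimal closedin_commuting_variety_nilpotent_cone)
       (auto intro: tuple_parametrization_in_commuting_variety)
qed

theorem theorem7p1p2:
  fixes C :: "(('k::alg_closed_field^3^3)^'r::finite) set"
  assumes "C = commuting_variety nilpotent_cone"
  shows "closedin zariski_matrix_tuples C \<and>
    irreducible_space (subtopology zariski_matrix_tuples C) \<and>
    krull_dim (subtopology zariski_matrix_tuples C) = enat (2 * CARD('r) + 4)"
proof -
  define r where "r = CARD('r)"
  have r_pos: "0 < r"
    by (simp add: r_def)
  obtain idx :: "'r \<Rightarrow> nat" where "bij_betw idx UNIV {..<r}"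
    using ex_bij_betw_finite_nat[of "UNIV :: 'r set"] by (auto simp: r_def lessThan_atLeast0)
  then have idx: "inj idx" "range idx = {..<r}"
    by (auto simp: bij_betw_def)
  have idx_less: "idx i < r" for i
    using idx(2) by auto
  have idx_inv: "idx (inv idx j) = j" if "j < r" for j
    using that idx(2) by (intro f_inv_into_f) auto
  let ?\<psi> = "tuple_parametrization idx :: (nat \<Rightarrow> 'k) \<Rightarrow> 'k^3^3^'r"
  \<comment> \<open>An arbitrary fixed index, used to detect the four parameters shared by all
    matrices.\<close>
  let ?i = "undefined :: 'r"
  note inf = infinite_UNIV_alg_closed_field[where 'k = 'k]
  have C: "C = zariski_closure matrix_tuple_coordinates (range ?\<psi>)"
    unfolding assms using commuting_variety_eq_closure_parametrization[OF inf] idx by (simp add: r_def)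
  have entries: "?\<psi> y $ i = (let a = y (idx i); b = y (r + idx i); c = y (2 * r) * a;
      u = y (2 * r + 1); q = y (2 * r + 2); p = y (2 * r + 3) in
    matrix_3
      (b * (p * u - q) - p * a) (a - u * b) b
      (p * (b * (p * u - q) - p * a) + c * (p * u - q)) (p * (a - u * b) - u * c) (p * b + c)
      (q * (b * (p * u - q) - p * a) + u * c * (p * u - q)) (q * (a - u * b) - u * (u * c)) (q * b + u * c))"
    for y i
    by (simp add: tuple_parametrization_def Let_def lower_unitriangular_conjugate_strict_upper r_def)
  \<comment> \<open>Once the parameters after \<open>j\<close> are zero, \<open>f j\<close> is up to
    sign a monomial divisible by parameter \<open>j\<close>: in turn \<open>a\<close>,
    \<open>b\<close>, \<open>c = t * a\<close>, \<open>u * c\<close>, \<open>q * b\<close> and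
    \<open>p * a * c\<close>. The last comes from the minor of rows 1, 2 and columns 1, 3.\<close>
  define f where "f j v =
      (if j < r then v $ inv idx j $ 1 $ 2
       else if j < 2 * r then v $ inv idx (j - r) $ 1 $ 3
       else if j = 2 * r then v $ ?i $ 2 $ 3
       else if j = 2 * r + 1 then v $ ?i $ 2 $ 2
       else if j = 2 * r + 2 then v $ ?i $ 1 $ 1
       else v $ ?i $ 1 $ 1 * v $ ?i $ 2 $ 3 - v $ ?i $ 1 $ 3 * v $ ?i $ 2 $ 1)"
    for j and v :: "'k^3^3^'r"
  have coords: "(\<lambda>y. c (?\<psi> y)) \<in> polynomial_functions (sequence_coordinates (2 * r + 4))"
    if c: "c \<in> matrix_tuple_coordinates" for c
  proof -
    have y_poly: "(\<lambda>y. y j) \<in> polynomial_functions (sequence_coordinates (2 * r + 4))"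
      if "j < 2 * r + 4" for j
      using that by (intro polynomial_functions.coord) auto
    have lower_poly: "(\<lambda>y. lower_unitriangular (y (2 * r + 3)) (y (2 * r + 1)) (y (2 * r + 2)) $ i $ j)
      \<in> polynomial_functions (sequence_coordinates (2 * r + 4))" for i j :: 3
      using exhaust_3[of i] exhaust_3[of j]
      by (auto intro!: y_poly polynomial_functions.const)
    obtain i j k where "c = (\<lambda>v. v $ i $ j $ k)"
      using c by (auto simp: matrix_tuple_coordinates_def)
    then have "(\<lambda>y. c (?\<psi> y)) = (\<lambda>y. ?\<psi> y $ i $ j $ k)"
      by simp
    moreover have "\<dots> \<in> polynomial_functions (sequence_coordinates (2 * r + 4))"
      unfolding tuple_parametrization_def Let_def r_def[symmetric] vec_lambda_beta using idx_less[of i]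
      by (intro polynomial_functions_conjugate_strict_upper polynomial_functions.mult
          lower_poly y_poly) simp_all
    ultimately show ?thesis
      by simp
  qed
  have f_poly: "f j \<in> polynomial_functions matrix_tuple_coordinates" for j
  proof -
    have entry: "(\<lambda>v. v $ i $ a $ b) \<in> polynomial_functions matrix_tuple_coordinates" for i a b
      by (intro polynomial_functions.coord) (auto simp: matrix_tuple_coordinates_def)
    show ?thesis
      unfolding f_def[abs_def]
      by (cases "j < r"; cases "j < 2 * r"; cases "j = 2 * r"; cases "j = 2 * r + 1";
          cases "j = 2 * r + 2")
         (simp_all add: entry polynomial_functions_diff polynomial_functions.mult)
  qed
  have vanish: "f j (?\<psi> y) = 0" if "j < 2 * r + 4" and y: "\<And>i. j \<le> i \<Longrightarrow> y i = 0" for j y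
    using that(1) idx_inv y unfolding f_def entries Let_def
    by (auto simp: algebra_simps)
  have nonzero: "\<exists>y. (\<forall>i>j. y i = 0) \<and> f j (?\<psi> y) \<noteq> 0" if "j < 2 * r + 4" for j
  proof -
    \<comment> \<open>At this point \<open>f j\<close> takes the value 1 or -1, which is nonzero in
      every characteristic.\<close>
    define y :: "nat \<Rightarrow> 'k" where "y i = (if i \<le> j then 1 else 0)" for i
    have "f j (?\<psi> y) \<noteq> 0"
      using that idx_inv idx_less[of ?i] r_pos unfolding f_def entries Let_def y_def
      by (auto simp: algebra_simps)
    then show ?thesis
      by (intro exI[of _ y]) (auto simp: y_def)
  qed
  show ?thesis
    using krull_dim_of_parametrization[OF inf coords f_poly vanish nonzero]
      closedin_commuting_variety_nilpotent_cone[where 'k = 'k and 'r = 'r]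
    unfolding C[symmetric] by (simp add: assms r_def)
qed

end
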